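(* Let $n_d=\sum_{i=0}^{d}\binom{n}{i}$. For integers $d$ with $1\le d\le n^{1/3}$, $Q^{p}(\mathrm{Pol}_{d})=\Theta(n_d)$ (in particular, for constant $d$, $Q^p(\mathrm{Pol}_d)=\Theta(n^d)$).
   Context: Boolean functions are maps $f:\mathbb{Z}_2^n\to\mathbb{Z}_2$; $f$ is $\epsilon$-far from a family $\mathcal{P}$ if $|\{x:f(x)\ne g(x)\}|\ge\epsilon2^n$ for all $g\in\mathcal{P}$. A passive $q$-query $\epsilon$-tester for $\mathcal{P}$ is a randomized algorithm that receives the values of an unknown $f$ on $q$ points of $\mathbb{Z}_2^n$ drawn uniformly at random and accepts with probability $\ge2/3$ if $f\in\mathcal{P}$ and rejects with probability $\ge2/3$ if $f$ is $\epsilon$-far from $\mathcal{P}$; $Q^p_\epsilon(\mathcal{P})$ is the minimal such $q$. $\epsilon$ is a fixed small constant (e.g. $0.001$) omitted from notation; asymptotics as $n\to\infty$. $\mathrm{Pol}_d$ is the family of functions $\mathbb{Z}_2^n\to\mathbb{Z}_2$ given by polynomials over $\mathbb{Z}_2$ of degree at most $d$ (there are $2^{n_d}$ of them). *)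

theory Defs
  imports
    "HOL-Probability.Probability"
    "HOL-Library.Z2"
    "HOL-Library.Poly_Mapping"
    "HOL-Library.Landau_Symbols"
begin

section \<open>Boolean functions\<close>

text \<open>The dimension varies inside the asymptotic statements, so vectors over \<open>\<int>\<^sub>2\<close>
  are extensional functions on \<open>{..<n}\<close>, and Boolean functions are extensional functions
  on the cube (so that equality is equality of values on the cube).\<close>

definition cube :: "nat \<Rightarrow> (nat \<Rightarrow> bit) set" where
  "cube n = {..<n} \<rightarrow>\<^sub>E UNIV"

definition bool_funs :: "nat \<Rightarrow> ((nat \<Rightarrow> bit) \<Rightarrow> bit) set" where
  "bool_funs n = cube n \<rightarrow>\<^sub>E UNIV"

definition eps_far :: "real \<Rightarrow> nat \<Rightarrow> ((nat \<Rightarrow> bit) \<Rightarrow> bit) set \<Rightarrow> ((nat \<Rightarrow> bit) \<Rightarrow> bit) \<Rightarrow> bool" where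
  "eps_far \<epsilon> n P f \<longleftrightarrow>
    (\<forall>g\<in>P. real (card {x \<in> cube n. f x \<noteq> g x}) \<ge> \<epsilon> * 2 ^ n)"

section \<open>Low-degree polynomials\<close>

text \<open>A polynomial over \<open>\<int>\<^sub>2\<close> maps finitely many monomials to nonzero coefficients; a monomial
  maps variable indices to exponents.  Exponents above 1 are allowed, as in the polynomial
  ring.\<close>

type_synonym bit_mpoly = "(nat \<Rightarrow>\<^sub>0 nat) \<Rightarrow>\<^sub>0 bit"

definition mono_degree :: "(nat \<Rightarrow>\<^sub>0 nat) \<Rightarrow> nat" where
  "mono_degree m = (\<Sum>i\<in>Poly_Mapping.keys m. Poly_Mapping.lookup m i)"

definition polys_deg_le :: "nat \<Rightarrow> nat \<Rightarrow> bit_mpoly set" where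
  "polys_deg_le n d = {p. \<forall>m\<in>Poly_Mapping.keys p. Poly_Mapping.keys m \<subseteq> {..<n} \<and> mono_degree m \<le> d}"

definition eval_mpoly :: "bit_mpoly \<Rightarrow> (nat \<Rightarrow> bit) \<Rightarrow> bit" where
  "eval_mpoly p x = (\<Sum>m\<in>Poly_Mapping.keys p. Poly_Mapping.lookup p m * (\<Prod>i\<in>Poly_Mapping.keys m. x i ^ Poly_Mapping.lookup m i))"

definition Pol :: "nat \<Rightarrow> nat \<Rightarrow> ((nat \<Rightarrow> bit) \<Rightarrow> bit) set" where
  "Pol n d = (\<lambda>p. restrict (eval_mpoly p) (cube n)) ` polys_deg_le n d"

definition num_monomials :: "nat \<Rightarrow> nat \<Rightarrow> nat" where
  "num_monomials n d = (\<Sum>i=0..d. n choose i)"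

section \<open>Passive testing\<close>

text \<open>A decision procedure \<open>A\<close> receives the list of labelled samples and answers with a random
  Boolean, where \<open>True\<close> means acceptance.  The \<open>q\<close> sample points are independent.\<close>

definition passive_run ::
    "nat \<Rightarrow> nat \<Rightarrow> (((nat \<Rightarrow> bit) \<times> bit) list \<Rightarrow> bool pmf) \<Rightarrow> ((nat \<Rightarrow> bit) \<Rightarrow> bit) \<Rightarrow> bool pmf" where
  "passive_run n q A f =
    bind_pmf (replicate_pmf q (pmf_of_set (cube n))) (\<lambda>xs. A (map (\<lambda>x. (x, f x)) xs))"

definition passive_tester ::
    "real \<Rightarrow> nat \<Rightarrow> ((nat \<Rightarrow> bit) \<Rightarrow> bit) set \<Rightarrow> nat \<Rightarrow>
     (((nat \<Rightarrow> bit) \<times> bit) list \<Rightarrow> bool pmf) \<Rightarrow> bool" where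
  "passive_tester \<epsilon> n P q A \<longleftrightarrow>
    (\<forall>f\<in>bool_funs n.
      (f \<in> P \<longrightarrow> pmf (passive_run n q A f) True \<ge> 2/3) \<and>
      (eps_far \<epsilon> n P f \<longrightarrow> pmf (passive_run n q A f) False \<ge> 2/3))"

text \<open>For \<open>\<epsilon> > 0\<close> the minimum is over a nonempty set: with sufficiently many samples all of
  the finite cube is seen with probability at least 2/3.\<close>

definition passive_query_complexity ::
    "real \<Rightarrow> nat \<Rightarrow> ((nat \<Rightarrow> bit) \<Rightarrow> bit) set \<Rightarrow> nat" where
  "passive_query_complexity \<epsilon> n P = (LEAST q. \<exists>A. passive_tester \<epsilon> n P q A)"

text \<open>The regime \<open>n \<rightarrow> \<infinity>\<close> with \<open>1 \<le> d \<le> n\<^sup>1\<^sup>/\<^sup>3\<close>, uniformly in \<open>d\<close>: a property of pairs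
  \<open>(n, d)\<close> holds eventually if from some \<open>n\<close> on it holds for all admissible \<open>d\<close>
  simultaneously.\<close>

definition low_degree_regime :: "(nat \<times> nat) filter" where
  "low_degree_regime =
    inf (filtercomap fst at_top) (principal {(n, d). 1 \<le> d \<and> real d \<le> real n powr (1/3)})"

lemma eventually_low_degree_regime:
  "eventually P low_degree_regime \<longleftrightarrow>
    (\<exists>N. \<forall>n\<ge>N. \<forall>d. 1 \<le> d \<and> real d \<le> real n powr (1/3) \<longrightarrow> P (n, d))"
proof
  assume "eventually P low_degree_regime"
  then obtain Q N where "\<forall>n\<ge>N. Q n"
      and "\<forall>z. Q (fst z) \<longrightarrow> z \<in> {(n, d). 1 \<le> d \<and> real d \<le> real n powr (1/3)} \<longrightarrow> P z"
    unfolding low_degree_regime_def eventually_inf_principal eventually_filtercomap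
      eventually_at_top_linorder by blast
  then show "\<exists>N. \<forall>n\<ge>N. \<forall>d. 1 \<le> d \<and> real d \<le> real n powr (1/3) \<longrightarrow> P (n, d)"
    by (intro exI[of _ N]) simp
next
  assume "\<exists>N. \<forall>n\<ge>N. \<forall>d. 1 \<le> d \<and> real d \<le> real n powr (1/3) \<longrightarrow> P (n, d)"
  then obtain N where "\<forall>n\<ge>N. \<forall>d. 1 \<le> d \<and> real d \<le> real n powr (1/3) \<longrightarrow> P (n, d)" by blast
  then show "eventually P low_degree_regime"
    unfolding low_degree_regime_def eventually_inf_principal eventually_filtercomap
    by (intro exI[of _ "\<lambda>n. N \<le> n"] conjI eventually_ge_at_top) auto
qed

end

theory Submission
  imports Defs "HOL-Real_Asymp.Real_Asymp"
begin

text \<open>Upper bound: accept if some polynomial agrees with all samples; a union bound over the at most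
  \<open>2 ^ n\<^sub>d\<close> polynomials shows that \<open>O(n\<^sub>d / \<epsilon>)\<close> samples suffice.

  Lower bound: fix \<open>h\<close> far from \<open>Pol\<^sub>d\<close>, which exists by counting.  If every labelling of the sample
  points is realised by a polynomial of degree \<open>d\<close>, then the values of a random polynomial \<open>f\<close> and of
  the far function \<open>f + h\<close> on the sample have the same distribution, so a tester must often see samples
  that do not interpolate.  Given an interpolating sample of fewer than \<open>r\<^sub>d\<close> points (\<open>r\<^sub>d\<close> being \<open>n\<^sub>d\<close>
  for \<open>n = r\<close>), fewer than \<open>2 ^ r\<close> points destroy this property: a set of \<open>2 ^ r\<close> points of the cube
  has at least \<open>2 ^ r\<^sub>d\<close> restrictions of polynomials of degree \<open>d\<close>.  Taking \<open>r = n - k\<close> with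
  \<open>2 ^ k \<ge> 4 n\<^sub>d\<close>, a union bound shows that \<open>r\<^sub>d\<close> samples interpolate with
  probability above \<open>2/3\<close>, and \<open>r\<^sub>d \<ge> n\<^sub>d / 2\<close> as \<open>k d \<approx> d\<^sup>2 log n\<close> is small compared with \<open>n\<close>.\<close>

section \<open>Counting integers of small binary weight\<close>

text \<open>\<open>light_count d m\<close> is the number of \<open>j < m\<close> with fewer than \<open>d\<close> ones in binary.  It is the
  extremal function for the rank of degree \<open>< d\<close> evaluations on \<open>m\<close> points, the minimum being attained
  by an initial segment of the cube in binary order.\<close>

fun light_count :: "nat \<Rightarrow> nat \<Rightarrow> nat" where
  "light_count 0 m = 0"
| "light_count (Suc d) m =
    (if m \<le> 1 then m else light_count (Suc d) (Suc m div 2) + light_count d (m div 2))"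

declare light_count.simps(2) [simp del]

lemma light_count_small [simp]:
  "light_count d 0 = 0" "light_count (Suc d) (Suc 0) = 1"
  by (cases d) (simp_all add: light_count.simps(2))

text \<open>The recursion splits off the lowest binary digit: \<open>2 * i\<close> has as many ones
  as \<open>i\<close>, and \<open>2 * i + 1\<close> has one more. The branch
  \<open>m \<le> 1\<close> stands apart because \<open>Suc m div 2 = m\<close> there.\<close>

lemma light_count_even: "light_count (Suc d) (2 * m) = light_count (Suc d) m + light_count d m"
  by (cases "m = 0") (simp_all add: light_count.simps(2)[of d "2 * m"])

lemma light_count_odd:
  "light_count (Suc d) (Suc (2 * m)) = light_count (Suc d) (Suc m) + light_count d m"
  by (cases "m = 0") (simp_all add: light_count.simps(2)[of d "Suc (2 * m)"])

lemma light_count_1: "light_count (Suc 0) m = min 1 m"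
proof (induction m rule: less_induct)
  case (less m)
  show ?case
  proof (cases "m \<le> 1")
    case False
    then have "Suc m div 2 < m" "Suc m div 2 \<ge> 1" by auto
    with less.IH[of "Suc m div 2"] False show ?thesis by (simp add: light_count.simps(2)[of 0 m])
  qed (simp add: light_count.simps(2))
qed

text \<open>Passing from \<open>m\<close> to \<open>Suc m\<close> raises
  \<open>light_count d\<close> by one exactly if \<open>m\<close> has fewer than \<open>d\<close>
  ones, a condition that weakens as \<open>d\<close> grows.\<close>

lemma light_count_Suc_diff:
  "light_count d (Suc m) + light_count (Suc d) m \<le> light_count (Suc d) (Suc m) + light_count d m"
proof (induction m arbitrary: d rule: less_induct)
  case (less m)
  show ?case
  proof (cases d)
    case 0
    then show ?thesis by (simp add: light_count_1)
  next
    case (Suc e)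
    consider "m = 0" | k where "m = 2 * k" "k < m" | k where "m = Suc (2 * k)" "k < m"
    proof (cases "even m")
      case True
      then obtain k where "m = 2 * k" ..
      with that show ?thesis by (cases "k = 0") auto
    next
      case False
      then obtain k where "m = 2 * k + 1" ..
      with that show ?thesis by auto
    qed
    then show ?thesis
    proof cases
      case 1
      with Suc show ?thesis by simp
    next
      case 2
      with less.IH[of k d] Suc show ?thesis
        by (simp add: light_count_even light_count_odd)
    next
      case 3
      with less.IH[of k e] Suc light_count_even[of _ "Suc k"] show ?thesis
        by (simp add: light_count_odd)
    qed
  qed
qed

lemma light_count_mono: "m \<le> m' \<Longrightarrow> light_count d m \<le> light_count d m'"
proof (rule lift_Suc_mono_le[of "light_count d"])
  show "light_count d k \<le> light_count d (Suc k)" for k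
  proof (induction d)
    case (Suc d)
    with light_count_Suc_diff[of d k] show ?case by linarith
  qed simp
qed

text \<open>Numerical counterpart of cutting a point set along a coordinate: the larger part, of
  size \<open>a\<close>, keeps its degree, and the smaller one, of size \<open>b\<close>, loses one.
  Halving both summands reduces this to the induction hypothesis, except that two odd summands
  produce a carry.\<close>

lemma light_count_add_le:
  "b \<le> a \<Longrightarrow> light_count (Suc d) (a + b) \<le> light_count (Suc d) a + light_count d b"
proof (induction "a + b" arbitrary: a b d rule: less_induct)
  case less
  show ?case
  proof (cases d)
    case 0
    with less.prems show ?thesis by (auto simp: light_count_1)
  next
    case (Suc e)
    show ?thesis
    proof (cases "b = 0")
      case False
      have IH: "light_count (Suc f) (a' + b') \<le> light_count (Suc f) a' + light_count f b'"
        if "a' + b' < a + b" "b' \<le> a'" for a' b' f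
        using less.hyps that by blast
      consider (ee) a' b' where "a = 2 * a'" "b = 2 * b'" | (oe) a' b' where "a = Suc (2 * a')" "b = 2 * b'"
        | (eo) a' b' where "a = 2 * a'" "b = Suc (2 * b')" | (oo) a' b' where "a = Suc (2 * a')" "b = Suc (2 * b')"
        by (metis evenE oddE Suc_eq_plus1)
      then show ?thesis
      proof cases
        case ee
        with False less.prems have "a' + b' < a + b" "b' \<le> a'" by auto
        with IH[of a' b' d] IH[of a' b' e] ee Suc light_count_even[of _ "a' + b'"] show ?thesis
          by (simp add: light_count_even)
      next
        case oe
        with False less.prems have "Suc a' + b' < a + b" "b' \<le> a'" by auto
        with IH[of "Suc a'" b' d] IH[of a' b' e] oe Suc light_count_odd[of _ "a' + b'"] show ?thesis
          by (simp add: light_count_even light_count_odd)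
      next
        case eo
        with less.prems have "a' + Suc b' < a + b" "Suc b' \<le> a'" by auto
        with IH[of a' "Suc b'" d] IH[of a' b' e] eo Suc light_count_odd[of _ "a' + b'"] show ?thesis
          by (simp add: light_count_even light_count_odd)
      next
        case oo
        with less.prems have le: "Suc a' + b' < a + b" "b' \<le> a'" by auto
        have sum: "a + b = 2 * Suc (a' + b')" using oo by simp
        have 1: "light_count (Suc d) (Suc (a' + b')) \<le> light_count (Suc d) (Suc a') + light_count d b'"
          using IH[of "Suc a'" b' d] le by simp
        \<comment> \<open>Because of the carry, both recursive terms have argument
          \<open>Suc (a' + b')\<close>. The extra unit goes to \<open>a'\<close> in \<open>1\<close>
          and, for distinct halves, to \<open>b'\<close> in \<open>2\<close>; adding the two cancels
          \<open>light_count d b'\<close>.\<close>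
        have 2: "light_count d (Suc (a' + b')) + light_count d b'
            \<le> light_count d a' + light_count d (Suc b') + light_count e b'"
        proof (cases "a' = b'")
          case True
          then show ?thesis using light_count_odd[of e b'] Suc by (simp flip: mult_2)
        next
          case False
          then have "light_count d (Suc (a' + b')) \<le> light_count d a' + light_count e (Suc b')"
            using IH[of a' "Suc b'" e] le Suc by simp
          then show ?thesis using light_count_Suc_diff[of e b'] unfolding Suc by linarith
        qed
        show ?thesis
          unfolding sum light_count_even using 1 2 oo Suc
          by (simp add: light_count_odd)
      qed
    qed simp
  qed
qed

section \<open>Comparison with sums of binomial coefficients\<close>

lemma num_monomials_Suc_Suc:
  "num_monomials (Suc n) (Suc d) = num_monomials n (Suc d) + num_monomials n d"
proof -
  have "num_monomials (Suc n) (Suc d) = 1 + (\<Sum>i=0..d. Suc n choose Suc i)"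
    unfolding num_monomials_def by (subst sum.atLeast0_atMost_Suc_shift) simp
  also have "\<dots> = (1 + (\<Sum>i=0..d. n choose Suc i)) + num_monomials n d"
    by (simp add: sum.distrib num_monomials_def)
  also have "1 + (\<Sum>i=0..d. n choose Suc i) = num_monomials n (Suc d)"
    unfolding num_monomials_def by (subst sum.atLeast0_atMost_Suc_shift) simp
  finally show ?thesis .
qed

text \<open>The numbers below \<open>2 ^ r\<close> are the \<open>r\<close>-bit strings, of which
  \<open>r choose i\<close> have \<open>i\<close> ones; both sides obey Pascal's recursion.\<close>

lemma light_count_power2: "light_count (Suc d) (2 ^ r) = num_monomials r d"
proof (induction r arbitrary: d)
  case 0
  have "num_monomials 0 d = 1" by (induction d) (simp_all add: num_monomials_def)
  then show ?case by simp
next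
  case (Suc r)
  show ?case
  proof (cases d)
    case 0
    then show ?thesis by (simp add: light_count_1 num_monomials_def)
  next
    case (Suc e)
    then show ?thesis using Suc.IH by (simp add: light_count_even num_monomials_Suc_Suc)
  qed
qed

section \<open>Functions of low degree\<close>

text \<open>By default the simplifier rewrites bit arithmetic to Boolean operations, which hides the field
  structure.\<close>

declare add_bit_eq_xor [simp del] mult_bit_eq_and [simp del] power_bit_unfold [simp del]

section \<open>Cardinalities of the cube and of its function space\<close>

lemma UNIV_bit: "(UNIV :: bit set) = {0, 1}"
  using bit_not_zero_iff by blast

lemma card_bit: "card (UNIV :: bit set) = 2"
  by (simp add: UNIV_bit)

lemma finite_bit: "finite (A :: bit set)"
  by (rule finite_subset[of _ UNIV]) (simp, simp only: UNIV_bit, simp)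

lemma finite_cube [simp]: "finite (cube n)"
  unfolding cube_def by (intro finite_PiE) (auto simp: finite_bit)

lemma card_cube: "card (cube n) = 2 ^ n"
  unfolding cube_def by (simp add: card_PiE card_bit)

lemma cube_nonempty: "cube n \<noteq> {}"
  using card_cube[of n] by auto

lemma finite_bool_funs: "finite (bool_funs n)"
  unfolding bool_funs_def by (intro finite_PiE) (auto simp: finite_bit)

lemma card_bool_funs: "card (bool_funs n) = 2 ^ 2 ^ n"
  unfolding bool_funs_def by (simp add: card_PiE card_bit card_cube)

lemma bit_add_self [simp]: "a + a = (0 :: bit)"
  by (cases a) simp_all

lemma bit_add_eq_0_iff: "a + b = 0 \<longleftrightarrow> a = (b :: bit)"
  by (cases a; cases b) simp_all

text \<open>The degree bound is strict, so that \<open>lowdeg n 0 = {0}\<close> and \<open>Pol n d = lowdeg n (Suc d)\<close>.\<close>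

definition lowdeg :: "nat \<Rightarrow> nat \<Rightarrow> ((nat \<Rightarrow> bit) \<Rightarrow> bit) set" where
  "lowdeg n d = range (\<lambda>c. \<lambda>x\<in>cube n. \<Sum>T | T \<subseteq> {..<n} \<and> card T < d. c T * (\<Prod>i\<in>T. x i))"

lemma lowdegI:
  "f = (\<lambda>x\<in>cube n. \<Sum>T | T \<subseteq> {..<n} \<and> card T < d. c T * (\<Prod>i\<in>T. x i)) \<Longrightarrow> f \<in> lowdeg n d"
  unfolding lowdeg_def by blast

lemma lowdegE:
  assumes "f \<in> lowdeg n d"
  obtains c where "f = (\<lambda>x\<in>cube n. \<Sum>T | T \<subseteq> {..<n} \<and> card T < d. c T * (\<Prod>i\<in>T. x i))"
  using assms unfolding lowdeg_def by blast

lemma finite_small_subsets [simp]: "finite {T. T \<subseteq> {..<n::nat} \<and> P T}"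
  by (rule finite_subset[of _ "Pow {..<n}"]) auto

lemma lowdeg_subset_bool_funs: "lowdeg n d \<subseteq> bool_funs n"
  unfolding lowdeg_def bool_funs_def by auto

lemma finite_lowdeg: "finite (lowdeg n d)"
  using finite_subset[OF lowdeg_subset_bool_funs finite_bool_funs] .

section \<open>Closure of low-degree functions under sums and multiplication by coordinates\<close>

lemma zero_in_lowdeg: "(\<lambda>x\<in>cube n. 0) \<in> lowdeg n d"
  by (rule lowdegI[where c = "\<lambda>_. 0"]) simp

lemma lowdeg_add:
  assumes "f \<in> lowdeg n d" "g \<in> lowdeg n d"
  shows "(\<lambda>x\<in>cube n. f x + g x) \<in> lowdeg n d"
proof -
  from assms obtain a b where
    "f = (\<lambda>x\<in>cube n. \<Sum>T | T \<subseteq> {..<n} \<and> card T < d. a T * (\<Prod>i\<in>T. x i))"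
    "g = (\<lambda>x\<in>cube n. \<Sum>T | T \<subseteq> {..<n} \<and> card T < d. b T * (\<Prod>i\<in>T. x i))"
    by (elim lowdegE)
  then show ?thesis
    by (intro lowdegI[where c = "\<lambda>T. a T + b T"]) (simp add: fun_eq_iff distrib_right sum.distrib)
qed

lemma lowdeg_sum:
  assumes "finite I" "\<And>j. j \<in> I \<Longrightarrow> (\<lambda>x\<in>cube n. f j x) \<in> lowdeg n d"
  shows "(\<lambda>x\<in>cube n. \<Sum>j\<in>I. f j x) \<in> lowdeg n d"
  using assms
proof (induction I rule: finite_induct)
  case empty
  show ?case by (simp only: sum.empty zero_in_lowdeg)
next
  case (insert j I)
  have "(\<lambda>x\<in>cube n. (\<lambda>x\<in>cube n. f j x) x + (\<lambda>x\<in>cube n. \<Sum>j\<in>I. f j x) x) \<in> lowdeg n d"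
    by (intro lowdeg_add[OF insert.prems insert.IH[OF insert.prems]] insertI1 insertI2)
  also have "(\<lambda>x\<in>cube n. (\<lambda>x\<in>cube n. f j x) x + (\<lambda>x\<in>cube n. \<Sum>j\<in>I. f j x) x)
      = (\<lambda>x\<in>cube n. \<Sum>j\<in>insert j I. f j x)"
    using insert.hyps by (auto simp: fun_eq_iff)
  finally show ?case .
qed

lemma monomial_in_lowdeg:
  assumes "T \<subseteq> {..<n}" "card T < d"
  shows "(\<lambda>x\<in>cube n. \<Prod>i\<in>T. x i) \<in> lowdeg n d"
proof (rule lowdegI[where c = "\<lambda>S. of_bool (S = T)"])
  have "(\<Sum>S | S \<subseteq> {..<n} \<and> card S < d. of_bool (S = T) * (\<Prod>i\<in>S. x i)) = (\<Prod>i\<in>T. x i)"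
    for x :: "nat \<Rightarrow> bit"
    using assms by (subst sum.mono_neutral_right[of _ "{T}"]) auto
  then show "(\<lambda>x\<in>cube n. \<Prod>i\<in>T. x i) = (\<lambda>x\<in>cube n. \<Sum>S | S \<subseteq> {..<n} \<and> card S < d.
      of_bool (S = T) * (\<Prod>i\<in>S. x i))"
    by simp
qed

lemma lowdeg_mono:
  assumes "f \<in> lowdeg n d" "d \<le> e"
  shows "f \<in> lowdeg n e"
proof -
  from assms(1) obtain c where
    f: "f = (\<lambda>x\<in>cube n. \<Sum>T | T \<subseteq> {..<n} \<and> card T < d. c T * (\<Prod>i\<in>T. x i))"
    by (elim lowdegE)
  show ?thesis unfolding f
  proof (rule lowdeg_sum)
    fix T assume "T \<in> {T. T \<subseteq> {..<n} \<and> card T < d}"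
    with assms(2) show "(\<lambda>x\<in>cube n. c T * (\<Prod>i\<in>T. x i)) \<in> lowdeg n e"
      by (cases "c T") (auto simp: zero_in_lowdeg monomial_in_lowdeg)
  qed simp
qed

lemma lowdeg_mult_var:
  assumes "f \<in> lowdeg n d" "k < n"
  shows "(\<lambda>x\<in>cube n. x k * f x) \<in> lowdeg n (Suc d)"
proof -
  from assms(1) obtain c where
    f: "f = (\<lambda>x\<in>cube n. \<Sum>T | T \<subseteq> {..<n} \<and> card T < d. c T * (\<Prod>i\<in>T. x i))"
    by (elim lowdegE)
  \<comment> \<open>Bits are idempotent, so \<open>x k\<close> times the monomial of
    \<open>T\<close> is the monomial of \<open>insert k T\<close>, even if
    \<open>k \<in> T\<close>.\<close>
  have "(\<lambda>x\<in>cube n. \<Sum>T | T \<subseteq> {..<n} \<and> card T < d. c T * (\<Prod>i\<in>insert k T. x i)) \<in> lowdeg n (Suc d)"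
  proof (rule lowdeg_sum)
    fix T assume T: "T \<in> {T. T \<subseteq> {..<n} \<and> card T < d}"
    then have "finite T" by (auto intro: finite_subset)
    with T have "card (insert k T) < Suc d" by (auto simp: card_insert_if)
    with assms(2) T show "(\<lambda>x\<in>cube n. c T * (\<Prod>i\<in>insert k T. x i)) \<in> lowdeg n (Suc d)"
      using monomial_in_lowdeg[of "insert k T" n "Suc d"]
      by (cases "c T") (auto simp: zero_in_lowdeg)
  qed simp
  also have "(\<lambda>x\<in>cube n. \<Sum>T | T \<subseteq> {..<n} \<and> card T < d. c T * (\<Prod>i\<in>insert k T. x i))
      = (\<lambda>x\<in>cube n. x k * f x)"
  proof -
    have "(\<Prod>i\<in>insert k T. x i) = x k * (\<Prod>i\<in>T. x i)" if "T \<subseteq> {..<n}" for T and x :: "nat \<Rightarrow> bit"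
    proof -
      have fin: "finite T" using that by (auto intro: finite_subset)
      have idem: "b * (b * a) = b * a" for a b :: bit by (cases b) simp_all
      show ?thesis
      proof (cases "k \<in> T")
        case True
        then show ?thesis
          by (simp only: prod.remove[OF fin True] insert_absorb idem)
      qed (simp add: fin)
    qed
    then show ?thesis
      by (simp add: f sum_distrib_left mult.left_commute[of "_ :: bit"] cong: restrict_cong)
  qed
  finally show ?thesis .
qed

text \<open>The factor \<open>x k + b\<close> is the indicator of the half
  \<open>x k \<noteq> b\<close>; a function can thus be switched off on the other half at the cost
  of one degree.\<close>

lemma lowdeg_mult_affine:
  assumes "f \<in> lowdeg n d" "k < n"
  shows "(\<lambda>x\<in>cube n. (x k + b) * f x) \<in> lowdeg n (Suc d)"
proof (cases b)
  case zero
  with lowdeg_mult_var[OF assms] show ?thesis by simp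
next
  case one
  have "(\<lambda>x\<in>cube n. (\<lambda>x\<in>cube n. x k * f x) x + f x) \<in> lowdeg n (Suc d)"
    by (intro lowdeg_add lowdeg_mult_var assms lowdeg_mono[OF assms(1)]) simp
  also have "(\<lambda>x\<in>cube n. (\<lambda>x\<in>cube n. x k * f x) x + f x) = (\<lambda>x\<in>cube n. (x k + b) * f x)"
    using one by (simp add: fun_eq_iff distrib_right)
  finally show ?thesis .
qed

section \<open>Counting low-degree functions\<close>

lemma card_small_subsets: "card {T. T \<subseteq> {..<n} \<and> card T < Suc d} = num_monomials n d"
proof -
  have "{T. T \<subseteq> {..<n} \<and> card T < Suc d} = (\<Union>i\<in>{0..d}. {T. T \<subseteq> {..<n} \<and> card T = i})"
    by auto
  also have "card \<dots> = (\<Sum>i=0..d. card {T. T \<subseteq> {..<n} \<and> card T = i})"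
    by (intro card_UN_disjoint ballI impI finite_small_subsets) auto
  also have "\<dots> = num_monomials n d"
    unfolding num_monomials_def by (simp only: n_subsets[OF finite_lessThan] card_lessThan)
  finally show ?thesis .
qed

text \<open>Coefficient vectors on the small subsets map onto the low-degree functions. The bound
  serves both the union bound of the tester and the existence of far functions.\<close>

lemma card_lowdeg_le: "card (lowdeg n (Suc d)) \<le> 2 ^ num_monomials n d"
proof -
  define T where "T = {T. T \<subseteq> {..<n} \<and> card T < Suc d}"
  define F :: "(nat set \<Rightarrow> bit) \<Rightarrow> (nat \<Rightarrow> bit) \<Rightarrow> bit"
    where "F = (\<lambda>c. \<lambda>x\<in>cube n. \<Sum>S\<in>T. c S * (\<Prod>i\<in>S. x i))"
  have fin: "finite T" unfolding T_def by (rule finite_small_subsets)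
  have "lowdeg n (Suc d) \<subseteq> F ` (T \<rightarrow>\<^sub>E UNIV)"
  proof
    fix f assume "f \<in> lowdeg n (Suc d)"
    then obtain c where "f = F c" unfolding T_def F_def by (elim lowdegE)
    also have "F c = F (restrict c T)" unfolding F_def by (intro restrict_ext sum.cong) auto
    finally have "f = F (restrict c T)" .
    then show "f \<in> F ` (T \<rightarrow>\<^sub>E UNIV)" by (rule image_eqI[where f = F]) simp
  qed
  then have "card (lowdeg n (Suc d)) \<le> card (T \<rightarrow>\<^sub>E (UNIV :: bit set))"
    by (intro surj_card_le[where f = F] finite_PiE fin finite_bit)
  also have "\<dots> = 2 ^ card T"
    by (simp add: card_PiE card_bit fin)
  finally show ?thesis unfolding T_def card_small_subsets .
qed

section \<open>Reduction of polynomials to multilinear form\<close>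

lemma eval_mpoly_superset:
  assumes "finite M" "Poly_Mapping.keys p \<subseteq> M"
  shows "eval_mpoly p x = (\<Sum>m\<in>M. Poly_Mapping.lookup p m *
    (\<Prod>i\<in>Poly_Mapping.keys m. x i ^ Poly_Mapping.lookup m i))"
  unfolding eval_mpoly_def using assms
  by (intro sum.mono_neutral_left) (auto simp: in_keys_iff simp del: bit_not_zero_iff bit_not_one_iff)

lemma eval_mpoly_add: "eval_mpoly (p + r) x = eval_mpoly p x + eval_mpoly r x"
proof -
  let ?M = "Poly_Mapping.keys p \<union> Poly_Mapping.keys r"
  show ?thesis
    using Poly_Mapping.keys_add[of p r]
    by (simp add: eval_mpoly_superset[of ?M] lookup_add distrib_right sum.distrib)
qed

text \<open>A positive power of a bit is the bit itself, so every monomial acts as the product of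
  its variables.\<close>

lemma monomial_eq_prod_keys:
  fixes x :: "nat \<Rightarrow> bit"
  shows "(\<Prod>i\<in>Poly_Mapping.keys m. x i ^ Poly_Mapping.lookup m i) = (\<Prod>i\<in>Poly_Mapping.keys m. x i)"
proof (rule prod.cong)
  fix i assume "i \<in> Poly_Mapping.keys m"
  then have "Poly_Mapping.lookup m i \<noteq> 0" by (simp add: in_keys_iff)
  then show "x i ^ Poly_Mapping.lookup m i = x i" by (cases "x i") simp_all
qed simp

lemma card_keys_le_mono_degree: "card (Poly_Mapping.keys m) \<le> mono_degree m"
proof -
  have "(\<Sum>i\<in>Poly_Mapping.keys m. 1) \<le> mono_degree m"
    unfolding mono_degree_def by (intro sum_mono) (auto simp: in_keys_iff)
  then show ?thesis by simp
qed

lemma monomial_in_Pol: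
  assumes "T \<subseteq> {..<n}" "card T \<le> d"
  shows "(\<lambda>x\<in>cube n. \<Prod>i\<in>T. x i) \<in> Pol n d"
proof -
  have fin: "finite T" using assms(1) by (auto intro: finite_subset)
  define m where "m = (\<Sum>i\<in>T. Poly_Mapping.single i (1::nat))"
  have lookup: "Poly_Mapping.lookup m i = of_bool (i \<in> T)" for i
    using fin unfolding m_def by (simp add: lookup_sum lookup_single when_def)
  then have keys: "Poly_Mapping.keys m = T" by (auto simp: in_keys_iff)
  have "Poly_Mapping.single m (1::bit) \<in> polys_deg_le n d"
    using assms by (simp add: polys_deg_le_def mono_degree_def keys lookup)
  moreover have "eval_mpoly (Poly_Mapping.single m 1) x = (\<Prod>i\<in>T. x i)" for x
    using monomial_eq_prod_keys[of x m] by (simp add: eval_mpoly_def keys)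
  ultimately show ?thesis
    unfolding Pol_def by (metis (no_types, lifting) imageI restrict_ext)
qed

text \<open>Dropping repeated factors does not raise the degree. Conversely, each multilinear
  monomial is a polynomial, and \<open>Pol n d\<close> is closed under addition.\<close>

lemma Pol_eq_lowdeg: "Pol n d = lowdeg n (Suc d)"
proof
  show "Pol n d \<subseteq> lowdeg n (Suc d)"
  proof
    fix f assume "f \<in> Pol n d"
    then obtain p where p: "p \<in> polys_deg_le n d" and f: "f = restrict (eval_mpoly p) (cube n)"
      unfolding Pol_def by blast
    \<comment> \<open>Distinct monomials of \<open>p\<close> may now give equal products; closure
      under sums absorbs such repetitions.\<close>
    have f': "f = (\<lambda>x\<in>cube n. \<Sum>m\<in>Poly_Mapping.keys p. \<Prod>i\<in>Poly_Mapping.keys m. x i)"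
      unfolding f eval_mpoly_def monomial_eq_prod_keys
      by (intro restrict_ext sum.cong) (auto simp: in_keys_iff)
    have "card (Poly_Mapping.keys m) < Suc d" "Poly_Mapping.keys m \<subseteq> {..<n}"
      if "m \<in> Poly_Mapping.keys p" for m
      using p that card_keys_le_mono_degree[of m] unfolding polys_deg_le_def by force+
    then show "f \<in> lowdeg n (Suc d)"
      unfolding f' by (intro lowdeg_sum monomial_in_lowdeg) auto
  qed
next
  have zero: "(\<lambda>x\<in>cube n. 0) \<in> Pol n d"
    unfolding Pol_def by (rule image_eqI[of _ _ 0]) (auto simp: polys_deg_le_def eval_mpoly_def)
  have add: "(\<lambda>x\<in>cube n. f x + g x) \<in> Pol n d" if fg: "f \<in> Pol n d" "g \<in> Pol n d" for f g
  proof -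
    from fg obtain p r where pr: "p \<in> polys_deg_le n d" "r \<in> polys_deg_le n d"
        "f = restrict (eval_mpoly p) (cube n)" "g = restrict (eval_mpoly r) (cube n)"
      unfolding Pol_def by blast
    then have "p + r \<in> polys_deg_le n d"
      using Poly_Mapping.keys_add[of p r] unfolding polys_deg_le_def by blast
    moreover have "(\<lambda>x\<in>cube n. f x + g x) = restrict (eval_mpoly (p + r)) (cube n)"
      using pr by (simp add: fun_eq_iff eval_mpoly_add)
    ultimately show ?thesis unfolding Pol_def by blast
  qed
  show "lowdeg n (Suc d) \<subseteq> Pol n d"
  proof
    fix f assume "f \<in> lowdeg n (Suc d)"
    then obtain c where
      f: "f = (\<lambda>x\<in>cube n. \<Sum>T | T \<subseteq> {..<n} \<and> card T < Suc d. c T * (\<Prod>i\<in>T. x i))"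
      by (elim lowdegE)
    have "(\<lambda>x\<in>cube n. \<Sum>T\<in>F. c T * (\<Prod>i\<in>T. x i)) \<in> Pol n d"
      if "finite F" "F \<subseteq> {T. T \<subseteq> {..<n} \<and> card T < Suc d}" for F
      using that
    proof (induction F rule: finite_induct)
      case (insert T F)
      have T: "(\<lambda>x\<in>cube n. c T * (\<Prod>i\<in>T. x i)) \<in> Pol n d"
        using insert.prems by (cases "c T") (auto simp: zero monomial_in_Pol)
      have "(\<lambda>x\<in>cube n. (\<lambda>x\<in>cube n. c T * (\<Prod>i\<in>T. x i)) x
          + (\<lambda>x\<in>cube n. \<Sum>T\<in>F. c T * (\<Prod>i\<in>T. x i)) x) \<in> Pol n d"
        by (rule add[OF T insert.IH]) (use insert.prems in auto)
      also have "(\<lambda>x\<in>cube n. (\<lambda>x\<in>cube n. c T * (\<Prod>i\<in>T. x i)) x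
          + (\<lambda>x\<in>cube n. \<Sum>T\<in>F. c T * (\<Prod>i\<in>T. x i)) x)
          = (\<lambda>x\<in>cube n. \<Sum>T\<in>insert T F. c T * (\<Prod>i\<in>T. x i))"
        using insert.hyps by (auto simp: fun_eq_iff)
      finally show ?case .
    qed (simp add: zero)
    then show "f \<in> Pol n d" unfolding f by simp
  qed
qed

section \<open>Restrictions to subsets of the cube\<close>

text \<open>For \<open>S\<close> in the cube the traces form a vector space over the two-element
  field, of dimension the rank of the evaluations at \<open>S\<close>. Its cardinality stands in for
  that rank, so linear algebra becomes counting.\<close>

definition traces :: "nat \<Rightarrow> nat \<Rightarrow> (nat \<Rightarrow> bit) set \<Rightarrow> ((nat \<Rightarrow> bit) \<Rightarrow> bit) set" where
  "traces n d S = (\<lambda>f. restrict f S) ` lowdeg n d"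

lemma finite_traces: "finite (traces n d S)"
  unfolding traces_def by (intro finite_imageI finite_lowdeg)

text \<open>On the half \<open>x k = b\<close> the function \<open>f + (x k + b) g\<close> restricts to \<open>f\<close>; on the other half it is \<open>f + g\<close>.\<close>

lemma card_traces_split:
  assumes S: "S \<subseteq> cube n" and k: "k < n"
  shows "card (traces n (Suc d) {x\<in>S. x k = b}) * card (traces n d {x\<in>S. x k \<noteq> b})
    \<le> card (traces n (Suc d) S)"
proof -
  define S0 S1 where "S0 = {x\<in>S. x k = b}" and "S1 = {x\<in>S. x k \<noteq> b}"
  \<comment> \<open>One extension is chosen per trace, so that \<open>p u\<close> depends on
    \<open>u\<close> alone. Once \<open>u = u'\<close> is known from \<open>S0\<close>, the term
    \<open>p u\<close> cancels on \<open>S1\<close>.\<close>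
  define p where "p = inv_into (lowdeg n (Suc d)) (\<lambda>f. restrict f S0)"
  define r where "r = inv_into (lowdeg n d) (\<lambda>f. restrict f S1)"
  have p: "p u \<in> lowdeg n (Suc d)" "restrict (p u) S0 = u" if "u \<in> traces n (Suc d) S0" for u
    using that unfolding p_def traces_def by (rule inv_into_into, rule f_inv_into_f)
  have r: "r v \<in> lowdeg n d" "restrict (r v) S1 = v" if "v \<in> traces n d S1" for v
    using that unfolding r_def traces_def by (rule inv_into_into, rule f_inv_into_f)
  define glue where "glue u v = (\<lambda>x\<in>cube n. p u x + (\<lambda>x\<in>cube n. (x k + b) * r v x) x)" for u v
  define G where "G = (\<lambda>(u, v). restrict (glue u v) S)"
  have glue_lowdeg: "glue u v \<in> lowdeg n (Suc d)"
    if "u \<in> traces n (Suc d) S0" "v \<in> traces n d S1" for u v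
    unfolding glue_def by (intro lowdeg_add lowdeg_mult_affine p(1) r(1) that k)
  have glue0: "glue u v x = p u x" if "x \<in> S0" for u v x
    using that S by (auto simp: glue_def S0_def)
  have glue1: "glue u v x = p u x + r v x" if "x \<in> S1" for u v x
  proof -
    have "x k \<noteq> b" "x \<in> cube n" using that S by (auto simp: S1_def)
    moreover from this have "x k + b = 1" by (cases "x k"; cases b) simp_all
    ultimately show ?thesis by (simp add: glue_def)
  qed
  have "inj_on G (traces n (Suc d) S0 \<times> traces n d S1)"
  proof (rule inj_onI, clarify)
    fix u v u' v'
    assume u: "u \<in> traces n (Suc d) S0" "u' \<in> traces n (Suc d) S0"
      and v: "v \<in> traces n d S1" "v' \<in> traces n d S1" and "G (u, v) = G (u', v')"
    then have eq: "glue u v x = glue u' v' x" if "x \<in> S" for x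
      using that unfolding G_def by (metis case_prod_conv restrict_apply')
    have "restrict (p u) S0 = restrict (p u') S0"
      using eq glue0 by (intro restrict_ext) (metis (no_types, lifting) S0_def mem_Collect_eq)
    with p u have uu: "u = u'" by metis
    have "restrict (r v) S1 = restrict (r v') S1"
    proof (rule restrict_ext)
      fix x assume x: "x \<in> S1"
      then have "glue u v x = glue u' v' x" by (intro eq) (simp add: S1_def)
      with uu show "r v x = r v' x" by (simp add: glue1[OF x])
    qed
    with r v have "v = v'" by metis
    with uu show "u = u' \<and> v = v'" ..
  qed
  moreover have "G ` (traces n (Suc d) S0 \<times> traces n d S1) \<subseteq> traces n (Suc d) S"
    unfolding G_def traces_def[of n "Suc d" S] by (auto intro!: imageI glue_lowdeg)
  ultimately have "card (traces n (Suc d) S0 \<times> traces n d S1) \<le> card (traces n (Suc d) S)"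
    by (rule card_inj_on_le[OF _ _ finite_traces])
  then show ?thesis
    by (simp add: card_cartesian_product S0_def S1_def)
qed

text \<open>Induction on the number \<open>k\<close> of coordinates in which the points may differ;
  for \<open>k = 0\<close> at most one point is left. Otherwise the set is cut along the last such
  coordinate: \<open>card_traces_split\<close> multiplies the bounds for the parts, and
  \<open>light_count_add_le\<close> recombines the exponents.\<close>

lemma card_traces_ge_aux:
  assumes "S \<subseteq> cube n" "k \<le> n" "\<forall>x\<in>S. \<forall>y\<in>S. \<forall>i\<in>{k..<n}. x i = y i"
  shows "2 ^ light_count d (card S) \<le> card (traces n d S)"
  using assms
proof (induction k arbitrary: S d)
  case 0
  have "x = y" if "x \<in> S" "y \<in> S" for x y
  proof (rule PiE_ext[of x "{..<n}" "\<lambda>_. UNIV" y])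
    show "x \<in> {..<n} \<rightarrow>\<^sub>E UNIV" "y \<in> {..<n} \<rightarrow>\<^sub>E UNIV"
      using 0 that unfolding cube_def by auto
    show "x i = y i" if "i \<in> {..<n}" for i
      using 0 that \<open>x \<in> S\<close> \<open>y \<in> S\<close> by simp
  qed
  then consider "S = {}" | a where "S = {a}" by blast
  then show ?case
  proof cases
    case 1
    with zero_in_lowdeg[of n d] show ?thesis
      by (auto simp: Suc_le_eq card_gt_0_iff finite_traces) (auto simp: traces_def)
  next
    case 2
    show ?thesis
    proof (cases d)
      case zero: 0
      with zero_in_lowdeg[of n d] show ?thesis
        by (auto simp: Suc_le_eq card_gt_0_iff finite_traces) (auto simp: traces_def)
    next
      case (Suc e)
      have a: "a \<in> cube n" using 0 2 by simp
      have "(\<lambda>x\<in>cube n. 1) \<in> lowdeg n d" "(\<lambda>x\<in>cube n. 0) \<in> lowdeg n d"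
        using monomial_in_lowdeg[of "{}" n d] Suc by (simp_all add: zero_in_lowdeg)
      then have "{restrict (\<lambda>x\<in>cube n. 1) S, restrict (\<lambda>x\<in>cube n. 0) S} \<subseteq> traces n d S"
        unfolding traces_def by blast
      then have "card {restrict (\<lambda>x\<in>cube n. 1 :: bit) S, restrict (\<lambda>x\<in>cube n. 0) S} \<le> card (traces n d S)"
        by (rule card_mono[OF finite_traces])
      moreover have "restrict (\<lambda>x\<in>cube n. 1 :: bit) S a \<noteq> restrict (\<lambda>x\<in>cube n. 0) S a"
        using 2 a by simp
      then have "restrict (\<lambda>x\<in>cube n. 1 :: bit) S \<noteq> restrict (\<lambda>x\<in>cube n. 0) S"
        by metis
      ultimately show ?thesis using 2 Suc by simp
    qed
  qed
next
  case (Suc k)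
  show ?case
  proof (cases d)
    case 0
    with zero_in_lowdeg[of n d] show ?thesis
      by (auto simp: Suc_le_eq card_gt_0_iff finite_traces) (auto simp: traces_def)
  next
    case d: (Suc e)
    define T where "T b = {x\<in>S. x k = b}" for b
    define T' where "T' b = {x\<in>S. x k \<noteq> b}" for b
    have fin: "finite S" using Suc.prems(1) finite_cube by (rule finite_subset)
    have "T' 0 = T 1" "T' 1 = T 0"
      unfolding T_def T'_def by auto
    \<comment> \<open>\<open>b\<close> is a majority value of coordinate \<open>k\<close>:
      \<open>light_count_add_le\<close> requires that the larger part keep the degree.\<close>
    then obtain b where b: "card (T' b) \<le> card (T b)"
      by (metis nle_le)
    have "card (T b \<union> T' b) = card (T b) + card (T' b)"
      using fin by (intro card_Un_disjoint) (auto simp: T_def T'_def)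
    also have "T b \<union> T' b = S" by (auto simp: T_def T'_def)
    finally have S: "card S = card (T b) + card (T' b)" .
    have "\<forall>x\<in>T b. \<forall>y\<in>T b. \<forall>i\<in>{k..<n}. x i = y i"
    proof (intro ballI)
      fix x y i assume "x \<in> T b" "y \<in> T b" "i \<in> {k..<n}"
      with Suc.prems(3) show "x i = y i"
        by (cases "i = k") (auto simp: T_def)
    qed
    moreover have "\<forall>x\<in>T' b. \<forall>y\<in>T' b. \<forall>i\<in>{k..<n}. x i = y i"
    proof (intro ballI)
      fix x y i assume *: "x \<in> T' b" "y \<in> T' b" "i \<in> {k..<n}"
      show "x i = y i"
      proof (cases "i = k")
        case True
        with * show ?thesis by (cases b) (auto simp: T'_def)
      qed (use * Suc.prems(3) in \<open>auto simp: T'_def\<close>)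
    qed
    moreover have "T b \<subseteq> cube n" "T' b \<subseteq> cube n"
      using Suc.prems(1) by (auto simp: T_def T'_def)
    ultimately have IH: "2 ^ light_count d (card (T b)) \<le> card (traces n d (T b))"
        "2 ^ light_count e (card (T' b)) \<le> card (traces n e (T' b))"
      using Suc.prems(2) by (auto intro!: Suc.IH)
    have "2 ^ light_count d (card S) \<le> (2::nat) ^ (light_count d (card (T b)) + light_count e (card (T' b)))"
      unfolding S d by (intro power_increasing light_count_add_le b) simp
    also have "\<dots> \<le> card (traces n d (T b)) * card (traces n e (T' b))"
      unfolding power_add by (intro mult_le_mono IH)
    also have "\<dots> \<le> card (traces n d S)"
      unfolding d T_def T'_def using Suc.prems by (intro card_traces_split) auto
    finally show ?thesis .
  qed
qed

lemma card_traces_ge: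
  assumes "S \<subseteq> cube n"
  shows "2 ^ light_count d (card S) \<le> card (traces n d S)"
  using card_traces_ge_aux[OF assms, of n d] by simp

section \<open>Interpolation and dependent points\<close>

definition interpolating :: "nat \<Rightarrow> nat \<Rightarrow> (nat \<Rightarrow> bit) set \<Rightarrow> bool" where
  "interpolating n d X \<longleftrightarrow> (\<forall>h. \<exists>f\<in>lowdeg n d. \<forall>x\<in>X. f x = h x)"

text \<open>For \<open>X\<close> in the cube these are the points whose evaluation on
  \<open>lowdeg n d\<close> lies in the span of the evaluations at \<open>X\<close>, expressed by
  duality. In the same language, \<open>interpolating\<close> says that the evaluations at
  \<open>X\<close> are linearly independent.\<close>

definition determined :: "nat \<Rightarrow> nat \<Rightarrow> (nat \<Rightarrow> bit) set \<Rightarrow> (nat \<Rightarrow> bit) set" where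
  "determined n d X = {x\<in>cube n. \<forall>f\<in>lowdeg n d. (\<forall>y\<in>X. f y = 0) \<longrightarrow> f x = 0}"

lemma finite_determined: "finite (determined n d X)"
  unfolding determined_def by simp

text \<open>Outside the determined set some \<open>g\<close> vanishes on \<open>X\<close> with
  \<open>g x = 1\<close>; adding it repairs a wrong value at \<open>x\<close>.\<close>

lemma interpolating_insert:
  assumes X: "interpolating n d X" "X \<subseteq> cube n" and x: "x \<in> cube n" "x \<notin> determined n d X"
  shows "interpolating n d (insert x X)"
  unfolding interpolating_def
proof
  fix h
  from X(1) obtain f where f: "f \<in> lowdeg n d" "\<forall>y\<in>X. f y = h y"
    unfolding interpolating_def by blast
  from x obtain g where g: "g \<in> lowdeg n d" "\<forall>y\<in>X. g y = 0" "g x = 1"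
    unfolding determined_def by auto
  show "\<exists>f\<in>lowdeg n d. \<forall>y\<in>insert x X. f y = h y"
  proof (cases "f x = h x")
    case True
    with f show ?thesis by auto
  next
    case False
    then have "f x + 1 = h x" by (cases "f x"; cases "h x") simp_all
    with f g X(2) x(1) have "\<forall>y\<in>insert x X. (\<lambda>x\<in>cube n. f x + g x) y = h y" by auto
    then show ?thesis using lowdeg_add[OF f(1) g(1)] by blast
  qed
qed

text \<open>The trace of a low-degree function on the determined set is fixed by its values on \<open>X\<close>, so there
  are at most \<open>2 ^ card X\<close> such traces.\<close>

lemma card_determined_less:
  assumes "X \<subseteq> cube n" "card X < num_monomials r d"
  shows "card (determined n (Suc d) X) < 2 ^ r"
proof (rule ccontr)
  let ?B = "determined n (Suc d) X"
  assume "\<not> ?thesis"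
  \<comment> \<open>A determined set this large would have at least
    \<open>2 ^ num_monomials r d\<close> traces, against at most \<open>2 ^ card X\<close>.\<close>
  then have "light_count (Suc d) (2 ^ r) \<le> light_count (Suc d) (card ?B)"
    by (intro light_count_mono) simp
  then have "num_monomials r d \<le> light_count (Suc d) (card ?B)"
    by (simp add: light_count_power2)
  then have "2 ^ num_monomials r d \<le> (2::nat) ^ light_count (Suc d) (card ?B)"
    by (intro power_increasing) simp_all
  also have "\<dots> \<le> card (traces n (Suc d) ?B)"
    by (intro card_traces_ge) (auto simp: determined_def)
  also have "\<dots> \<le> card (X \<rightarrow>\<^sub>E (UNIV :: bit set))"
  proof (rule surj_card_le)
    have finX: "finite X" using assms(1) finite_cube by (rule finite_subset)
    show "finite (X \<rightarrow>\<^sub>E (UNIV :: bit set))"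
      by (intro finite_PiE finX finite_bit)
    have same: "restrict f ?B = restrict g ?B"
      if fg: "f \<in> lowdeg n (Suc d)" "g \<in> lowdeg n (Suc d)" and eq: "restrict f X = restrict g X" for f g
    proof (rule restrict_ext)
      fix x assume x: "x \<in> ?B"
      then have xc: "x \<in> cube n" by (simp add: determined_def)
      have "f y = g y" if "y \<in> X" for y using eq that by (metis restrict_apply')
      then have "\<forall>y\<in>X. (\<lambda>x\<in>cube n. f x + g x) y = 0" using assms(1) by auto
      with x lowdeg_add[OF fg] have "(\<lambda>x\<in>cube n. f x + g x) x = 0"
        unfolding determined_def by blast
      with xc show "f x = g x" by (simp add: bit_add_eq_0_iff)
    qed
    define ext where "ext = inv_into (lowdeg n (Suc d)) (\<lambda>f. restrict f X)"
    show "traces n (Suc d) ?B \<subseteq> (\<lambda>u. restrict (ext u) ?B) ` (X \<rightarrow>\<^sub>E UNIV)"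
    proof
      fix t assume "t \<in> traces n (Suc d) ?B"
      then obtain f where f: "f \<in> lowdeg n (Suc d)" "t = restrict f ?B" unfolding traces_def by blast
      then have "restrict f X \<in> (\<lambda>f. restrict f X) ` lowdeg n (Suc d)" by blast
      then have "ext (restrict f X) \<in> lowdeg n (Suc d)" "restrict (ext (restrict f X)) X = restrict f X"
        unfolding ext_def by (rule inv_into_into, rule f_inv_into_f)
      with f same have "t = restrict (ext (restrict f X)) ?B" by metis
      then show "t \<in> (\<lambda>u. restrict (ext u) ?B) ` (X \<rightarrow>\<^sub>E UNIV)"
        by (rule image_eqI[where f = "\<lambda>u. restrict (ext u) ?B"]) simp
    qed
  qed
  also have "\<dots> = 2 ^ card X"
    using finite_subset[OF assms(1) finite_cube] by (simp add: card_PiE card_bit)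
  finally show False using assms(2) by simp
qed

section \<open>Samples that fail to interpolate\<close>

definition samples :: "nat \<Rightarrow> nat \<Rightarrow> (nat \<Rightarrow> bit) list set" where
  "samples n q = {xs. set xs \<subseteq> cube n \<and> length xs = q}"

lemma finite_samples [simp]: "finite (samples n q)"
  unfolding samples_def by (intro finite_lists_length_eq finite_cube)

lemma card_samples: "card (samples n q) = 2 ^ (n * q)"
  unfolding samples_def by (simp add: card_lists_length_eq card_cube power_mult)

definition bad_samples :: "nat \<Rightarrow> nat \<Rightarrow> nat \<Rightarrow> (nat \<Rightarrow> bit) list set" where
  "bad_samples n d q = {xs\<in>samples n q. \<not> interpolating n d (set xs)}"

text \<open>A union bound with denominators cleared: a bad list has a bad tail, or its head lies in
  the determined set of the tail, which has probability below \<open>2 ^ r / 2 ^ n\<close>. The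
  bound on \<open>q\<close> keeps every tail below \<open>num_monomials r d\<close> points, as
  \<open>card_determined_less\<close> demands.\<close>

lemma card_bad_samples_le:
  "q \<le> num_monomials r d \<Longrightarrow> card (bad_samples n (Suc d) q) * 2 ^ n \<le> q * 2 ^ r * 2 ^ (n * q)"
proof (induction q)
  case 0
  have "interpolating n (Suc d) {}"
    unfolding interpolating_def using zero_in_lowdeg by blast
  then have "bad_samples n (Suc d) 0 = {}" by (auto simp: bad_samples_def samples_def)
  then show ?case by simp
next
  case (Suc q)
  let ?A = "bad_samples n (Suc d) q \<times> cube n"
  let ?B = "SIGMA xs:samples n q. determined n (Suc d) (set xs)"
  have fin: "finite ?A" "finite ?B"
    by (auto intro!: finite_SigmaI finite_determined simp: bad_samples_def)
  have "bad_samples n (Suc d) (Suc q) \<subseteq> (\<lambda>(xs, x). x # xs) ` (?A \<union> ?B)"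
  proof
    fix ys assume ys: "ys \<in> bad_samples n (Suc d) (Suc q)"
    then obtain x xs where x: "ys = x # xs" "x \<in> cube n" "xs \<in> samples n q"
      unfolding bad_samples_def samples_def by (cases ys) auto
    have "(xs, x) \<in> ?A \<union> ?B"
    proof (rule ccontr)
      assume "(xs, x) \<notin> ?A \<union> ?B"
      with x have "interpolating n (Suc d) (set xs)" "x \<notin> determined n (Suc d) (set xs)"
        by (auto simp: bad_samples_def)
      with x have "interpolating n (Suc d) (set ys)"
        using interpolating_insert by (simp add: samples_def)
      with ys show False by (simp add: bad_samples_def)
    qed
    with x(1) show "ys \<in> (\<lambda>(xs, x). x # xs) ` (?A \<union> ?B)" by force
  qed
  then have "card (bad_samples n (Suc d) (Suc q)) \<le> card (?A \<union> ?B)"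
    by (rule surj_card_le[rotated]) (use fin in simp)
  also have "\<dots> \<le> card ?A + card ?B" by (rule card_Un_le)
  also have "card ?A = card (bad_samples n (Suc d) q) * 2 ^ n"
    by (simp add: card_cartesian_product card_cube)
  also have "card ?B = (\<Sum>xs\<in>samples n q. card (determined n (Suc d) (set xs)))"
    by (simp add: finite_determined)
  also have "\<dots> \<le> (\<Sum>xs\<in>samples n q. 2 ^ r)"
  proof (rule sum_mono)
    fix xs assume "xs \<in> samples n q"
    then have "set xs \<subseteq> cube n" "card (set xs) < num_monomials r d"
      using Suc.prems card_length[of xs] by (auto simp: samples_def)
    then show "card (determined n (Suc d) (set xs)) \<le> 2 ^ r"
      by (intro card_determined_less[THEN less_imp_le])
  qed
  also have "\<dots> = 2 ^ (n * q) * 2 ^ r" by (simp add: card_samples)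
  finally have "card (bad_samples n (Suc d) (Suc q)) \<le> q * 2 ^ r * 2 ^ (n * q) + 2 ^ (n * q) * 2 ^ r"
    using Suc by linarith
  then have "card (bad_samples n (Suc d) (Suc q)) * 2 ^ n
      \<le> (q * 2 ^ r * 2 ^ (n * q) + 2 ^ (n * q) * 2 ^ r) * 2 ^ n"
    by (rule mult_le_mono1)
  also have "\<dots> = Suc q * 2 ^ r * 2 ^ (n * Suc q)"
    by (simp add: algebra_simps power_add)
  finally show ?case .
qed

section \<open>Testers\<close>

text \<open>Turns probabilities of a run into averages over a finite set of lists, so that the rest
  is counting.\<close>

lemma pmf_bind_samples:
  "pmf (bind_pmf (replicate_pmf q (pmf_of_set (cube n))) F) b
    = (\<Sum>xs\<in>samples n q. pmf (F xs) b) / 2 ^ (n * q)"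
proof (induction q arbitrary: F)
  case 0
  have "samples n 0 = {[]}" by (auto simp: samples_def)
  then show ?case by (simp add: bind_return_pmf)
next
  case (Suc q)
  have samples: "samples n (Suc q) = (\<lambda>(x, xs). x # xs) ` (cube n \<times> samples n q)"
    by (force simp: samples_def length_Suc_conv)
  have "pmf (bind_pmf (replicate_pmf (Suc q) (pmf_of_set (cube n))) F) b
      = pmf (bind_pmf (pmf_of_set (cube n))
          (\<lambda>x. bind_pmf (replicate_pmf q (pmf_of_set (cube n))) (\<lambda>xs. F (x # xs)))) b"
    by (simp add: bind_assoc_pmf bind_return_pmf)
  also have "\<dots> = (\<Sum>x\<in>cube n. (\<Sum>xs\<in>samples n q. pmf (F (x # xs)) b) / 2 ^ (n * q)) / 2 ^ n"
    by (simp add: pmf_bind_pmf_of_set cube_nonempty card_cube Suc.IH)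
  also have "\<dots> = (\<Sum>(x, xs)\<in>cube n \<times> samples n q. pmf (F (x # xs)) b) / 2 ^ (n * Suc q)"
    by (simp add: sum.cartesian_product power_add flip: sum_divide_distrib)
  also have "(\<Sum>(x, xs)\<in>cube n \<times> samples n q. pmf (F (x # xs)) b)
      = (\<Sum>xs\<in>samples n (Suc q). pmf (F xs) b)"
    unfolding samples by (subst sum.reindex) (auto simp: inj_on_def case_prod_unfold)
  finally show ?case .
qed

lemma pmf_passive_run:
  "pmf (passive_run n q A f) b
    = (\<Sum>xs\<in>samples n q. pmf (A (map (\<lambda>x. (x, f x)) xs)) b) / 2 ^ (n * q)"
  unfolding passive_run_def pmf_bind_samples ..

text \<open>The distance from \<open>f + h\<close> to \<open>g\<close> equals that from
  \<open>h\<close> to \<open>f + g\<close>, and \<open>f + g\<close> again has low degree.\<close>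

lemma eps_far_shift:
  assumes "f \<in> lowdeg n d" "eps_far \<epsilon> n (lowdeg n d) h"
  shows "eps_far \<epsilon> n (lowdeg n d) (\<lambda>x\<in>cube n. f x + h x)"
  unfolding eps_far_def
proof
  fix g assume g: "g \<in> lowdeg n d"
  have "f x + h x \<noteq> g x \<longleftrightarrow> h x \<noteq> f x + g x" for x
    by (cases "f x"; cases "h x"; cases "g x") simp_all
  then have eq: "{x \<in> cube n. (\<lambda>x\<in>cube n. f x + h x) x \<noteq> g x} = {x \<in> cube n. h x \<noteq> (\<lambda>x\<in>cube n. f x + g x) x}"
    by auto
  show "\<epsilon> * 2 ^ n \<le> real (card {x \<in> cube n. (\<lambda>x\<in>cube n. f x + h x) x \<noteq> g x})"
    unfolding eq using assms(2) lowdeg_add[OF assms(1) g] unfolding eps_far_def by blast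
qed

text \<open>Since \<open>g + g = 0\<close>, the translation is its own inverse.\<close>

lemma bij_betw_lowdeg_shift:
  assumes g: "g \<in> lowdeg n d"
  shows "bij_betw (\<lambda>f. \<lambda>x\<in>cube n. f x + g x) (lowdeg n d) (lowdeg n d)"
proof (rule bij_betw_byWitness[where f' = "\<lambda>f. \<lambda>x\<in>cube n. f x + g x"])
  have "(\<lambda>x\<in>cube n. (\<lambda>x\<in>cube n. f x + g x) x + g x) = f" if "f \<in> lowdeg n d" for f
  proof
    have "f \<in> extensional (cube n)"
      using that lowdeg_subset_bool_funs[of n d] by (auto simp: bool_funs_def PiE_def)
    then show "(\<lambda>x\<in>cube n. (\<lambda>x\<in>cube n. f x + g x) x + g x) x = f x" for x
      by (auto simp: add.assoc extensional_def)
  qed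
  then show "\<forall>f\<in>lowdeg n d. (\<lambda>x\<in>cube n. (\<lambda>x\<in>cube n. f x + g x) x + g x) = f"
    "\<forall>f\<in>lowdeg n d. (\<lambda>x\<in>cube n. (\<lambda>x\<in>cube n. f x + g x) x + g x) = f" by blast+
qed (auto intro: lowdeg_add g)

text \<open>On an interpolating sample the far function \<open>h\<close> agrees with some \<open>g\<close> of low degree, and the
  translation by \<open>g\<close> permutes the low-degree functions.  Hence the tester accepts a random low-degree
  \<open>f\<close> and the far function \<open>f + h\<close> with the same probability.\<close>

lemma many_bad_samples:
  assumes tester: "passive_tester \<epsilon> n (lowdeg n d) q A" and far: "eps_far \<epsilon> n (lowdeg n d) h"
  shows "2 ^ (n * q) \<le> 3 * card (bad_samples n d q)"
proof -
  let ?V = "lowdeg n d"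
  define acc where "acc xs f = pmf (A (map (\<lambda>x. (x, f x)) xs)) True" for xs f
  define shift where "shift f = (\<lambda>x\<in>cube n. f x + h x)" for f
  have acc: "0 \<le> acc xs f" "acc xs f \<le> 1" for xs f
    unfolding acc_def by (simp_all add: pmf_le_1)
  \<comment> \<open>Acceptance has probability at least 2/3 on \<open>f\<close> and at most 1/3 on
    its far shift.\<close>
  have gap: "1 / 3 \<le> pmf (passive_run n q A f) True - pmf (passive_run n q A (shift f)) True"
    if f: "f \<in> ?V" for f
  proof -
    have "shift f \<in> bool_funs n" by (simp add: shift_def bool_funs_def)
    moreover have "eps_far \<epsilon> n ?V (shift f)"
      unfolding shift_def by (rule eps_far_shift[OF f far])
    ultimately have "2 / 3 \<le> pmf (passive_run n q A (shift f)) False"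
      using tester unfolding passive_tester_def by blast
    moreover have "2 / 3 \<le> pmf (passive_run n q A f) True"
      using tester f lowdeg_subset_bool_funs unfolding passive_tester_def by blast
    ultimately show ?thesis by (simp add: pmf_False_conv_True)
  qed
  have good: "(\<Sum>f\<in>?V. acc xs f - acc xs (shift f)) = 0"
    if xs: "xs \<in> samples n q" "xs \<notin> bad_samples n d q" for xs
  proof -
    from xs have "interpolating n d (set xs)" by (simp add: bad_samples_def)
    then obtain g where g: "g \<in> ?V" "\<forall>x\<in>set xs. g x = h x" unfolding interpolating_def by blast
    have "acc xs (shift f) = acc xs (\<lambda>x\<in>cube n. f x + g x)" for f
      unfolding acc_def shift_def using g(2) xs(1)
      by (intro arg_cong[of _ _ "\<lambda>zs. pmf (A zs) True"]) (auto simp: samples_def)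
    then have "(\<Sum>f\<in>?V. acc xs (shift f)) = (\<Sum>f\<in>?V. acc xs f)"
      using sum.reindex_bij_betw[OF bij_betw_lowdeg_shift[OF g(1)]] by simp
    then show ?thesis by (simp add: sum_subtractf)
  qed
  have "real (card ?V) / 3 = (\<Sum>f\<in>?V. 1 / 3)" by simp
  also have "\<dots> \<le> (\<Sum>f\<in>?V. pmf (passive_run n q A f) True - pmf (passive_run n q A (shift f)) True)"
    by (rule sum_mono) (rule gap)
  also have "\<dots> = (\<Sum>f\<in>?V. \<Sum>xs\<in>samples n q. acc xs f - acc xs (shift f)) / 2 ^ (n * q)"
    by (simp add: pmf_passive_run acc_def sum_subtractf diff_divide_distrib sum_divide_distrib)
  also have "(\<Sum>f\<in>?V. \<Sum>xs\<in>samples n q. acc xs f - acc xs (shift f))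
      = (\<Sum>xs\<in>samples n q. \<Sum>f\<in>?V. acc xs f - acc xs (shift f))"
    by (rule sum.swap)
  \<comment> \<open>Good samples contribute nothing and each bad one at most \<open>card ?V\<close>,
    so at least a third of all samples must be bad.\<close>
  also have "\<dots> = (\<Sum>xs\<in>bad_samples n d q. \<Sum>f\<in>?V. acc xs f - acc xs (shift f))"
    by (rule sum.mono_neutral_right) (auto simp: good, simp add: bad_samples_def)
  also have "\<dots> \<le> (\<Sum>xs\<in>bad_samples n d q. \<Sum>f\<in>?V. 1)"
    using acc by (intro sum_mono) (smt (verit))
  finally have "real (card ?V) / 3 \<le> real (card (bad_samples n d q)) * real (card ?V) / 2 ^ (n * q)"
    by (simp add: divide_right_mono)
  moreover have "0 < card ?V"
    using zero_in_lowdeg[of n d] finite_lowdeg by (auto simp: card_gt_0_iff)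
  ultimately have "2 ^ (n * q) \<le> 3 * real (card (bad_samples n d q))"
    by (simp add: field_simps)
  then have "real (2 ^ (n * q)) \<le> real (3 * card (bad_samples n d q))" by simp
  then show ?thesis by (simp only: of_nat_le_iff)
qed

text \<open>Members of \<open>P\<close> are always accepted. A far function agrees with a fixed
  \<open>g\<close> on at most a fraction \<open>1 - \<epsilon>\<close> of the cube, so
  \<open>g\<close> survives all draws with probability at most
  \<open>(1 - \<epsilon>) ^ q\<close>.\<close>

lemma passive_tester_exists:
  assumes fin: "finite P" and eps: "\<epsilon> \<le> 1" and q: "real (card P) * (1 - \<epsilon>) ^ q \<le> 1 / 3"
  shows "\<exists>A. passive_tester \<epsilon> n P q A"
proof
  define A :: "((nat \<Rightarrow> bit) \<times> bit) list \<Rightarrow> bool pmf"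
    where "A zs = return_pmf (\<exists>g\<in>P. \<forall>(x, y)\<in>set zs. g x = y)" for zs
  have run: "pmf (passive_run n q A f) True
      = card {xs\<in>samples n q. \<exists>g\<in>P. \<forall>x\<in>set xs. g x = f x} / 2 ^ (n * q)" for f
  proof -
    have "pmf (A (map (\<lambda>x. (x, f x)) xs)) True = of_bool (\<exists>g\<in>P. \<forall>x\<in>set xs. g x = f x)" for xs
      unfolding A_def by (auto simp: pmf_return)
    then show ?thesis
      by (simp add: pmf_passive_run sum.If_cases Int_def of_bool_def)
  qed
  show "passive_tester \<epsilon> n P q A"
    unfolding passive_tester_def
  proof (intro ballI conjI impI)
    fix f assume "f \<in> P"
    then have "{xs\<in>samples n q. \<exists>g\<in>P. \<forall>x\<in>set xs. g x = f x} = samples n q" by auto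
    then show "2 / 3 \<le> pmf (passive_run n q A f) True" by (simp add: run card_samples)
  next
    fix f assume far: "eps_far \<epsilon> n P f"
    define agree where "agree g = {x\<in>cube n. g x = f x}" for g
    have agree: "real (card (agree g)) \<le> (1 - \<epsilon>) * 2 ^ n" if "g \<in> P" for g
    proof -
      have "card (agree g) + card {x \<in> cube n. f x \<noteq> g x} = card (agree g \<union> {x \<in> cube n. f x \<noteq> g x})"
        by (rule card_Un_disjoint[symmetric]) (auto simp: agree_def)
      also have "agree g \<union> {x \<in> cube n. f x \<noteq> g x} = cube n" by (auto simp: agree_def)
      finally have "real (card (agree g)) + real (card {x \<in> cube n. f x \<noteq> g x}) = 2 ^ n"
        by (simp add: card_cube flip: of_nat_add)
      with far that show ?thesis unfolding eps_far_def by (fastforce simp: algebra_simps)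
    qed
    have "{xs\<in>samples n q. \<exists>g\<in>P. \<forall>x\<in>set xs. g x = f x}
        \<subseteq> (\<Union>g\<in>P. {xs. set xs \<subseteq> agree g \<and> length xs = q})"
      by (auto simp: samples_def agree_def)
    then have "card {xs\<in>samples n q. \<exists>g\<in>P. \<forall>x\<in>set xs. g x = f x}
        \<le> card (\<Union>g\<in>P. {xs. set xs \<subseteq> agree g \<and> length xs = q})"
      by (rule card_mono[rotated]) (auto intro!: finite_lists_length_eq fin simp: agree_def)
    also have "\<dots> \<le> (\<Sum>g\<in>P. card {xs. set xs \<subseteq> agree g \<and> length xs = q})"
      by (rule card_UN_le[OF fin])
    also have "\<dots> = (\<Sum>g\<in>P. card (agree g) ^ q)"
      by (intro sum.cong refl card_lists_length_eq) (simp add: agree_def)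
    finally have "real (card {xs\<in>samples n q. \<exists>g\<in>P. \<forall>x\<in>set xs. g x = f x})
        \<le> real (\<Sum>g\<in>P. card (agree g) ^ q)" by (rule of_nat_mono)
    also have "\<dots> = (\<Sum>g\<in>P. real (card (agree g)) ^ q)" by simp
    also have "\<dots> \<le> (\<Sum>g\<in>P. ((1 - \<epsilon>) * 2 ^ n) ^ q)"
      by (intro sum_mono power_mono agree) simp_all
    also have "\<dots> = (real (card P) * (1 - \<epsilon>) ^ q) * 2 ^ (n * q)"
      by (simp add: power_mult_distrib power_mult)
    also have "\<dots> \<le> 1 / 3 * 2 ^ (n * q)" by (intro mult_right_mono q) simp
    finally have "pmf (passive_run n q A f) True \<le> 1 / 3" by (simp add: run divide_le_eq)
    then show "2 / 3 \<le> pmf (passive_run n q A f) False" by (simp add: pmf_False_conv_True)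
  qed
qed

section \<open>Functions far from low degree\<close>

lemma sum_power_card_Pow:
  fixes t :: "'a :: comm_semiring_1"
  assumes "finite A"
  shows "(\<Sum>E\<in>Pow A. t ^ card E) = (t + 1) ^ card A"
  using prod_add[OF assms, of "\<lambda>_. t" "\<lambda>_. 1"] by simp

text \<open>Chernoff-type estimate: weighting \<open>E\<close> by \<open>(1 / 8) ^ card E\<close>
  gives total weight \<open>(9 / 8) ^ card A\<close>, while each counted set weighs at least
  \<open>(1 / 8) ^ k\<close>. Fourth powers yield an integral bound, because
  \<open>(9 / 8) ^ 4 \<le> 2\<close> and \<open>8 ^ 4 = 2 ^ 12\<close>.\<close>

lemma card_small_sets_le:
  assumes "finite A"
  shows "card {E. E \<subseteq> A \<and> card E \<le> k} ^ 4 \<le> 2 ^ (12 * k + card A)"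
proof -
  let ?B = "{E. E \<subseteq> A \<and> card E \<le> k}"
  have "real (card ?B) * (1 / 8) ^ k = (\<Sum>E\<in>?B. (1 / 8) ^ k)" by simp
  also have "\<dots> \<le> (\<Sum>E\<in>?B. (1 / 8) ^ card E)"
    by (intro sum_mono power_decreasing) auto
  also have "\<dots> \<le> (\<Sum>E\<in>Pow A. (1 / 8) ^ card E)"
    using assms by (intro sum_mono2) auto
  also have "\<dots> = (9 / 8) ^ card A" by (simp add: sum_power_card_Pow[OF assms])
  finally have "real (card ?B) \<le> 8 ^ k * (9 / 8) ^ card A" by (simp add: field_simps)
  then have "real (card ?B) ^ 4 \<le> (8 ^ k * (9 / 8) ^ card A) ^ 4" by (rule power_mono) simp
  also have "\<dots> = (8 ^ 4) ^ k * ((9 / 8) ^ 4) ^ card A"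
    by (simp only: power_mult_distrib mult.commute flip: power_mult)
  also have "\<dots> \<le> (2 ^ 12) ^ k * 2 ^ card A"
    by (intro mult_mono power_mono) (simp_all add: power_divide)
  also have "\<dots> = 2 ^ (12 * k + card A)" by (simp only: power_add power_mult)
  finally have "real (card ?B ^ 4) \<le> real (2 ^ (12 * k + card A))" by simp
  then show ?thesis by (simp only: of_nat_le_iff)
qed

text \<open>If no function were far, each would be a low-degree function plus the indicator of a set
  of at most \<open>2 ^ n div 1000\<close> points, and there are too few such pairs.\<close>

lemma eps_far_exists:
  assumes eps: "\<epsilon> \<le> 1 / 1000" and nd: "2 * num_monomials n d \<le> 2 ^ n"
  obtains h where "eps_far \<epsilon> n (lowdeg n (Suc d)) h"
proof (rule ccontr)
  assume "\<not> thesis"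
  with that have near: "\<not> eps_far \<epsilon> n (lowdeg n (Suc d)) h" for h by blast
  define k where "k = 2 ^ n div (1000 :: nat)"
  let ?B = "{E. E \<subseteq> cube n \<and> card E \<le> k}"
  let ?F = "\<lambda>(f, E). \<lambda>x\<in>cube n. f x + of_bool (x \<in> E)"
  have finB: "finite ?B" by (rule finite_subset[of _ "Pow (cube n)"]) auto
  have "bool_funs n \<subseteq> ?F ` (lowdeg n (Suc d) \<times> ?B)"
  proof
    fix h assume h: "h \<in> bool_funs n"
    from near obtain f where f: "f \<in> lowdeg n (Suc d)"
      and less: "real (card {x\<in>cube n. h x \<noteq> f x}) < \<epsilon> * 2 ^ n"
      unfolding eps_far_def by (meson not_le)
    define E where "E = {x\<in>cube n. h x \<noteq> f x}"
    have "\<epsilon> * 2 ^ n \<le> 1 / 1000 * 2 ^ n" using eps by (intro mult_right_mono) simp_all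
    with less have "1000 * real (card E) < 2 ^ n" unfolding E_def by linarith
    then have "real (1000 * card E) < real (2 ^ n)" by simp
    then have "1000 * card E < 2 ^ n" by (simp only: of_nat_less_iff)
    then have E: "E \<in> ?B" by (auto simp: E_def k_def)
    have "h = ?F (f, E)"
    proof
      fix x
      show "h x = ?F (f, E) x"
      proof (cases "x \<in> cube n")
        case True
        then show ?thesis by (cases "h x"; cases "f x") (auto simp: E_def)
      next
        case False
        with h show ?thesis by (auto simp: bool_funs_def PiE_def extensional_def)
      qed
    qed
    then show "h \<in> ?F ` (lowdeg n (Suc d) \<times> ?B)"
      by (rule image_eqI[where f = ?F]) (use f E in simp)
  qed
  then have "card (bool_funs n) \<le> card (lowdeg n (Suc d) \<times> ?B)"
    by (rule surj_card_le[rotated]) (intro finite_cartesian_product finite_lowdeg finB)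
  then have "2 ^ 2 ^ n \<le> card (lowdeg n (Suc d)) * card ?B"
    by (simp add: card_bool_funs card_cartesian_product)
  also have "\<dots> \<le> 2 ^ num_monomials n d * card ?B"
    by (intro mult_le_mono1 card_lowdeg_le)
  finally have "(2 ^ 2 ^ n) ^ 4 \<le> (2 ^ num_monomials n d * card ?B) ^ 4"
    by (rule power_mono) simp
  also have "\<dots> = 2 ^ (4 * num_monomials n d) * card ?B ^ 4"
    by (simp only: power_mult_distrib mult.commute flip: power_mult)
  also have "\<dots> \<le> 2 ^ (4 * num_monomials n d) * 2 ^ (12 * k + 2 ^ n)"
    using card_small_sets_le[OF finite_cube, of n k] by (intro mult_le_mono2) (simp add: card_cube)
  also have "\<dots> = 2 ^ (4 * num_monomials n d + (12 * k + 2 ^ n))"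
    by (simp only: power_add)
  finally have "(2::nat) ^ (4 * 2 ^ n) \<le> 2 ^ (4 * num_monomials n d + (12 * k + 2 ^ n))"
    by (simp only: mult.commute flip: power_mult)
  then have "4 * 2 ^ n \<le> 4 * num_monomials n d + (12 * k + 2 ^ n)"
    by (rule power_le_imp_le_exp[rotated]) simp
  \<comment> \<open>By \<open>nd\<close> the first summand is at most \<open>2 * 2 ^ n\<close>,
    which leaves \<open>2 ^ n \<le> 12 * k\<close>, although \<open>k\<close> is at most a
    thousandth of \<open>2 ^ n\<close>.\<close>
  with nd have "2 ^ n \<le> 12 * k" by linarith
  moreover have "1000 * k \<le> 2 ^ n" unfolding k_def by (rule times_div_less_eq_dividend)
  ultimately show False using zero_less_power[of "2::nat" n] by linarith
qed

section \<open>Asymptotics\<close>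

lemma num_monomials_pos: "0 < num_monomials n d"
  by (induction d) (simp_all add: num_monomials_def)

lemma num_monomials_mono: "m \<le> n \<Longrightarrow> num_monomials m d \<le> num_monomials n d"
  using light_count_mono[of "2 ^ m" "2 ^ n" "Suc d"] by (simp add: light_count_power2)

text \<open>This crude bound is precise enough: only its logarithm enters the choice of
  \<open>k\<close> in \<open>query_complexity_lower\<close>, and for constant \<open>d\<close> the
  factor \<open>2 ^ d\<close> is a constant.\<close>

lemma num_monomials_le:
  assumes "1 \<le> n"
  shows "num_monomials n d \<le> (2 * n) ^ d"
proof (induction d)
  case (Suc d)
  have "n choose Suc d \<le> n ^ Suc d"
    by (cases "Suc d \<le> n") (simp_all add: binomial_le_pow binomial_eq_0 del: power_Suc)
  also have "\<dots> = n * n ^ d" by simp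
  also have "\<dots> \<le> n * (2 * n) ^ d" by (intro mult_le_mono2 power_mono) simp_all
  finally have "n choose Suc d \<le> n * (2 * n) ^ d" .
  moreover have "(2 * n) ^ d \<le> n * (2 * n) ^ d" using assms by simp
  moreover have "num_monomials n (Suc d) = num_monomials n d + (n choose Suc d)"
    by (simp add: num_monomials_def)
  moreover have "(2 * n) ^ Suc d = n * (2 * n) ^ d + n * (2 * n) ^ d" by simp
  ultimately show ?case using Suc by linarith
qed (simp add: num_monomials_def)

text \<open>Holds term by term: the ratio of \<open>m choose i\<close> to
  \<open>Suc m choose i\<close> is \<open>1 - i / Suc m\<close>.\<close>

lemma num_monomials_Suc_le:
  assumes "d \<le> m"
  shows "(1 - real d / real (Suc m)) * real (num_monomials (Suc m) d) \<le> real (num_monomials m d)"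
proof -
  have "(1 - real d / real (Suc m)) * real (Suc m choose i) \<le> real (m choose i)" if "i \<le> d" for i
  proof -
    have "real (Suc m - i) * real (Suc m choose i) = real (Suc m) * real (m choose i)"
      using binomial_absorb_comp[of "Suc m" i] by (metis diff_Suc_1 of_nat_mult)
    moreover have "(real (Suc m) - real d) * real (Suc m choose i)
        \<le> real (Suc m - i) * real (Suc m choose i)"
      using that assms by (intro mult_right_mono) simp_all
    ultimately have "(real (Suc m) - real d) * real (Suc m choose i) \<le> real (Suc m) * real (m choose i)"
      by linarith
    then show ?thesis by (simp add: field_simps)
  qed
  then show ?thesis
    unfolding num_monomials_def of_nat_sum sum_distrib_left by (intro sum_mono) simp
qed

lemma num_monomials_add_le:
  assumes "d \<le> m" "0 < m"
  shows "(1 - real k * real d / real m) * real (num_monomials (m + k) d) \<le> real (num_monomials m d)"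
proof (induction k)
  case (Suc k)
  define t where "t = real d / real m"
  have t: "0 \<le> t" by (simp add: t_def)
  let ?S = "real (num_monomials (m + Suc k) d)"
  show ?case
  \<comment> \<open>Iteration uses \<open>(1 - k * t) * (1 - t) \<ge> 1 - Suc k * t\<close>.
    Multiplying by \<open>1 - k * t\<close> needs its sign; if it is negative, the left side of the
    claim is at most zero.\<close>
  proof (cases "real k * t \<le> 1")
    case True
    have "real d / real (Suc (m + k)) \<le> t"
      unfolding t_def using assms by (intro divide_left_mono) simp_all
    then have "(1 - t) * ?S \<le> (1 - real d / real (Suc (m + k))) * ?S"
      by (intro mult_right_mono) simp_all
    also have "\<dots> \<le> real (num_monomials (m + k) d)"
      using num_monomials_Suc_le[of d "m + k"] assms by simp
    finally have "(1 - real k * t) * ((1 - t) * ?S) \<le> (1 - real k * t) * real (num_monomials (m + k) d)"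
      using True by (intro mult_left_mono) simp_all
    also have "\<dots> \<le> real (num_monomials m d)" using Suc by (simp add: t_def)
    finally have "((1 - real k * t) * (1 - t)) * ?S \<le> real (num_monomials m d)" by (simp add: mult.assoc)
    moreover have "(1 - real (Suc k) * t) * ?S \<le> ((1 - real k * t) * (1 - t)) * ?S"
      using t by (intro mult_right_mono) (simp_all add: algebra_simps)
    ultimately show ?thesis by (simp add: t_def)
  next
    case False
    with t have "1 - real (Suc k) * t \<le> 0" by (simp add: algebra_simps)
    then have "(1 - real (Suc k) * t) * ?S \<le> 0" by (intro mult_nonpos_nonneg) simp_all
    also have "0 \<le> real (num_monomials m d)" by simp
    finally show ?thesis by (simp add: t_def)
  qed
qed simp

text \<open>Otherwise the union bound with \<open>r = n - k\<close> makes at most a fraction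
  \<open>q / 2 ^ k \<le> 1 / 4\<close> of the samples bad, while \<open>many_bad_samples\<close>
  asks for a third.\<close>

lemma tester_needs_samples:
  assumes eps: "\<epsilon> \<le> 1 / 1000" and tester: "passive_tester \<epsilon> n (Pol n d) q A"
    and k: "4 * num_monomials n d \<le> 2 ^ k" "k \<le> n"
  shows "num_monomials (n - k) d < q"
proof (rule ccontr)
  assume "\<not> num_monomials (n - k) d < q"
  then have q: "q \<le> num_monomials (n - k) d" by simp
  have "2 * num_monomials n d \<le> 2 ^ k" using k(1) by linarith
  also have "\<dots> \<le> 2 ^ n" using k(2) by (intro power_increasing) simp_all
  finally obtain h where "eps_far \<epsilon> n (lowdeg n (Suc d)) h"
    using eps_far_exists[OF eps] by blast
  then have "2 ^ (n * q) \<le> 3 * card (bad_samples n (Suc d) q)"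
    using tester many_bad_samples unfolding Pol_eq_lowdeg by blast
  then have "2 ^ n * 2 ^ (n * q) \<le> 3 * (card (bad_samples n (Suc d) q) * 2 ^ n)" by simp
  also have "\<dots> \<le> 3 * (q * 2 ^ (n - k) * 2 ^ (n * q))"
    by (intro mult_le_mono2 card_bad_samples_le q)
  finally have "(2::nat) ^ n \<le> 3 * q * 2 ^ (n - k)" by simp
  moreover have "(2::nat) ^ n = 2 ^ k * 2 ^ (n - k)" using k(2) by (simp flip: power_add)
  ultimately have "2 ^ k \<le> 3 * q" by simp
  with q k(1) num_monomials_mono[of "n - k" n d] num_monomials_pos[of n d] show False
    by simp
qed

text \<open>The polynomials number at most \<open>exp (num_monomials n d)\<close>, and
  \<open>(1 - \<epsilon>) ^ q \<le> exp (- \<epsilon> * q)\<close>. The summand 2 in the hypothesis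
  leaves \<open>exp (- 2) \<le> 1 / 3\<close>.\<close>

lemma tester_exists_num_monomials:
  assumes "0 < \<epsilon>" "\<epsilon> \<le> 1" and q: "real (num_monomials n d) + 2 \<le> \<epsilon> * real q"
  shows "\<exists>A. passive_tester \<epsilon> n (Pol n d) q A"
  unfolding Pol_eq_lowdeg
proof (rule passive_tester_exists)
  let ?S = "num_monomials n d"
  have "real (card (lowdeg n (Suc d))) \<le> 2 ^ ?S"
    using card_lowdeg_le[of n d] by (metis of_nat_le_iff of_nat_numeral of_nat_power)
  also have "\<dots> \<le> exp 1 ^ ?S" using exp_ge_add_one_self[of 1] by (intro power_mono) simp_all
  also have "\<dots> = exp (real ?S)" by (simp flip: exp_of_nat_mult)
  finally have card: "real (card (lowdeg n (Suc d))) \<le> exp (real ?S)" .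
  have "(1 - \<epsilon>) ^ q \<le> exp (- \<epsilon>) ^ q"
    using assms(2) exp_ge_add_one_self[of "- \<epsilon>"] by (intro power_mono) simp_all
  also have "\<dots> = exp (- (\<epsilon> * real q))" by (simp add: mult.commute flip: exp_of_nat_mult)
  also have "\<dots> \<le> exp (- (real ?S + 2))" using q by simp
  finally have "(1 - \<epsilon>) ^ q \<le> exp (- (real ?S + 2))" .
  with card have "real (card (lowdeg n (Suc d))) * (1 - \<epsilon>) ^ q \<le> exp (real ?S) * exp (- (real ?S + 2))"
    using assms(2) by (intro mult_mono) simp_all
  also have "\<dots> = 1 / exp 2" by (simp add: exp_minus divide_inverse flip: exp_add)
  also have "\<dots> \<le> 1 / 3" using exp_ge_add_one_self[of 2] by (intro divide_left_mono) simp_all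
  finally show "real (card (lowdeg n (Suc d))) * (1 - \<epsilon>) ^ q \<le> 1 / 3" .
qed (use assms finite_lowdeg in auto)

text \<open>The second claim certifies that the \<open>LEAST\<close> is attained; the lower bound is
  applied to the tester it provides.\<close>

lemma query_complexity_upper:
  assumes "0 < \<epsilon>" "\<epsilon> \<le> 1"
  shows "real (passive_query_complexity \<epsilon> n (Pol n d)) \<le> 4 / \<epsilon> * real (num_monomials n d)"
    and "\<exists>A. passive_tester \<epsilon> n (Pol n d) (passive_query_complexity \<epsilon> n (Pol n d)) A"
proof -
  let ?S = "num_monomials n d"
  define q where "q = nat \<lceil>(real ?S + 2) / \<epsilon>\<rceil>"
  have "0 \<le> (real ?S + 2) / \<epsilon>" using assms(1) by simp
  have "(real ?S + 2) / \<epsilon> \<le> real q" unfolding q_def by linarith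
  then have "real ?S + 2 \<le> \<epsilon> * real q" using assms by (simp add: field_simps)
  then have ex: "\<exists>A. passive_tester \<epsilon> n (Pol n d) q A"
    by (rule tester_exists_num_monomials[OF assms])
  from LeastI[of "\<lambda>q. \<exists>A. passive_tester \<epsilon> n (Pol n d) q A", OF ex]
  show "\<exists>A. passive_tester \<epsilon> n (Pol n d) (passive_query_complexity \<epsilon> n (Pol n d)) A"
    unfolding passive_query_complexity_def .
  have "passive_query_complexity \<epsilon> n (Pol n d) \<le> q"
    unfolding passive_query_complexity_def using ex by (rule Least_le)
  then have "real (passive_query_complexity \<epsilon> n (Pol n d)) \<le> real q" by simp
  also have "real q \<le> (real ?S + 2) / \<epsilon> + 1"
    unfolding q_def using \<open>0 \<le> (real ?S + 2) / \<epsilon>\<close> by linarith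
  \<comment> \<open>The 1 lost to rounding up is at most \<open>1 / \<epsilon>\<close>, and
    \<open>3 \<le> 3 * ?S\<close> then gives the constant 4.\<close>
  also have "\<dots> \<le> (real ?S + 2) / \<epsilon> + 1 / \<epsilon>" using assms by simp
  also have "\<dots> = (real ?S + 3) / \<epsilon>" by (simp add: add_divide_distrib)
  also have "\<dots> \<le> (4 * real ?S) / \<epsilon>"
    using assms(1) num_monomials_pos[of n d] by (intro divide_right_mono) simp_all
  finally show "real (passive_query_complexity \<epsilon> n (Pol n d)) \<le> 4 / \<epsilon> * real ?S" by simp
qed

lemma query_complexity_lower:
  assumes "0 < \<epsilon>" "\<epsilon> \<le> 1 / 1000" and d: "1 \<le> d" "real d \<le> real n powr (1 / 3)" and n: "1 \<le> n"
    and large: "3 * real n powr (1 / 3) * (real n powr (1 / 3) * log 2 (2 * real n) + 3) \<le> real n"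
  shows "real (num_monomials n d) / 2 \<le> real (passive_query_complexity \<epsilon> n (Pol n d))"
proof -
  \<comment> \<open>Chosen so that \<open>2 ^ k\<close> is at least \<open>4 * (2 * n) ^ d\<close>;
    the summand 2 accounts for the factor 4.\<close>
  define k where "k = nat \<lceil>real d * log 2 (2 * real n)\<rceil> + 2"
  have log: "0 \<le> log 2 (2 * real n)" using n by simp
  have k_ge: "real d * log 2 (2 * real n) + 2 \<le> real k" unfolding k_def by linarith
  have "0 \<le> real d * log 2 (2 * real n)" using log by simp
  then have "real k \<le> real d * log 2 (2 * real n) + 3" unfolding k_def by linarith
  also have "\<dots> \<le> real n powr (1 / 3) * log 2 (2 * real n) + 3"
    using d(2) log by (intro add_right_mono mult_right_mono)
  finally have "3 * real d * real k \<le> 3 * real n powr (1 / 3) * (real n powr (1 / 3) * log 2 (2 * real n) + 3)"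
    using d(2) by (intro mult_mono) simp_all
  with large have "real (3 * d * k) \<le> real n" by simp
  then have dk: "3 * d * k \<le> n" by (simp only: of_nat_le_iff)
  \<comment> \<open>Of the three copies of \<open>d * k\<close> in \<open>dk\<close>, one pays for
    the \<open>k\<close> lost dimensions and two make \<open>k * d / (n - k)\<close> at most 1/2, so
    that at least half of the binomial sum survives.\<close>
  have "k \<le> d * k" using mult_le_mono1[OF d(1), of k] by simp
  moreover have "2 * d \<le> d * k" using mult_le_mono2[of 2 k d] by (simp add: k_def)
  moreover have "3 * (d * k) \<le> n" using dk by simp
  ultimately have k: "2 * (k * d) \<le> n - k" "k \<le> n" "d \<le> n - k" "0 < n - k"
    unfolding mult.commute[of k d] using d(1) by linarith+
  have "real (num_monomials n d) \<le> real ((2 * n) ^ d)"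
    using num_monomials_le[OF n, of d] by (simp only: of_nat_le_iff)
  then have "4 * real (num_monomials n d) \<le> 4 * (2 * real n) ^ d" by simp
  also have "(2 * real n) ^ d = (2 powr log 2 (2 * real n)) powr real d"
    using n by (simp add: powr_realpow)
  also have "\<dots> = 2 powr (real d * log 2 (2 * real n))"
    by (simp only: powr_powr mult.commute)
  also have "4 * \<dots> = 2 powr (real d * log 2 (2 * real n) + 2)"
    by (simp add: powr_add)
  also have "\<dots> \<le> 2 powr real k" using k_ge by simp
  also have "\<dots> = 2 ^ k" by (simp add: powr_realpow)
  finally have "real (4 * num_monomials n d) \<le> real (2 ^ k)" by simp
  then have "4 * num_monomials n d \<le> 2 ^ k" by (simp only: of_nat_le_iff)
  moreover obtain A where "passive_tester \<epsilon> n (Pol n d) (passive_query_complexity \<epsilon> n (Pol n d)) A"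
    using query_complexity_upper(2)[of \<epsilon> n d] assms by auto
  ultimately have "num_monomials (n - k) d < passive_query_complexity \<epsilon> n (Pol n d)"
    using tester_needs_samples k(2) assms(2) by blast
  moreover have "real (num_monomials n d) / 2 \<le> real (num_monomials (n - k) d)"
  proof -
    have "real (2 * (k * d)) \<le> real (n - k)" using k(1) by (simp only: of_nat_le_iff)
    then have "1 / 2 \<le> 1 - real k * real d / real (n - k)" using k(4) by (simp add: field_simps)
    then have "1 / 2 * real (num_monomials n d)
        \<le> (1 - real k * real d / real (n - k)) * real (num_monomials n d)"
      by (rule mult_right_mono) simp
    also have "\<dots> \<le> real (num_monomials (n - k) d)"
      using num_monomials_add_le[OF k(3,4), of k] k(2) by simp
    finally show ?thesis by simp
  qed
  ultimately show ?thesis by linarith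
qed

theorem theorem10:
  fixes \<epsilon> :: real
  assumes "0 < \<epsilon>" and "\<epsilon> \<le> 1/1000"
  shows "(\<lambda>(n, d). real (passive_query_complexity \<epsilon> n (Pol n d)))
           \<in> \<Theta>[low_degree_regime](\<lambda>(n, d). real (num_monomials n d)) \<and>
         (\<forall>d\<ge>1. (\<lambda>n. real (passive_query_complexity \<epsilon> n (Pol n d))) \<in> \<Theta>(\<lambda>n. real n ^ d))"
proof (intro conjI allI impI)
  let ?Q = "\<lambda>n d. real (passive_query_complexity \<epsilon> n (Pol n d))"
  have upper: "?Q n d \<le> 4 / \<epsilon> * real (num_monomials n d)" for n d
    using assms by (intro query_complexity_upper) simp_all
  \<comment> \<open>The left side has order \<open>n powr (2 / 3) * log n\<close>. As
    \<open>d\<close> does not occur, the threshold \<open>N\<close> is uniform over the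
    regime.\<close>
  have "\<forall>\<^sub>F n in at_top. 1 \<le> n \<and>
      3 * real n powr (1 / 3) * (real n powr (1 / 3) * log 2 (2 * real n) + 3) \<le> real n"
    by (intro eventually_conj eventually_ge_at_top) real_asymp
  then obtain N where N: "1 \<le> n"
      "3 * real n powr (1 / 3) * (real n powr (1 / 3) * log 2 (2 * real n) + 3) \<le> real n"
    if "N \<le> n" for n
    unfolding eventually_at_top_linorder by blast
  have lower: "real (num_monomials n d) / 2 \<le> ?Q n d"
    if "N \<le> n" "1 \<le> d" "real d \<le> real n powr (1 / 3)" for n d
    using assms that N[OF that(1)] by (intro query_complexity_lower) simp_all
  show "(\<lambda>(n, d). ?Q n d) \<in> \<Theta>[low_degree_regime](\<lambda>(n, d). real (num_monomials n d))"
  proof (rule bigthetaI)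
    show "(\<lambda>(n, d). ?Q n d) \<in> O[low_degree_regime](\<lambda>(n, d). real (num_monomials n d))"
      using upper by (intro bigoI[of _ "4 / \<epsilon>"] always_eventually) auto
    show "(\<lambda>(n, d). ?Q n d) \<in> \<Omega>[low_degree_regime](\<lambda>(n, d). real (num_monomials n d))"
      by (rule landau_omega.bigI[of "1 / 2"])
        (auto simp: eventually_low_degree_regime intro!: exI[of _ N] dest: lower)
  qed
  fix d :: nat assume d: "1 \<le> d"
  show "(\<lambda>n. ?Q n d) \<in> \<Theta>(\<lambda>n. real n ^ d)"
  proof (rule bigthetaI)
    show "(\<lambda>n. ?Q n d) \<in> O(\<lambda>n. real n ^ d)"
    proof (rule bigoI)
      show "\<forall>\<^sub>F n in at_top. norm (?Q n d) \<le> 4 / \<epsilon> * 2 ^ d * norm (real n ^ d)"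
        using eventually_ge_at_top[of 1]
      proof eventually_elim
        case (elim n)
        have "real (num_monomials n d) \<le> real ((2 * n) ^ d)"
          using num_monomials_le[OF elim] by (simp only: of_nat_le_iff)
        then have "4 / \<epsilon> * real (num_monomials n d) \<le> 4 / \<epsilon> * real ((2 * n) ^ d)"
          using assms(1) by (intro mult_left_mono) simp_all
        with upper[of n d] show ?case by (simp add: power_mult_distrib mult.assoc)
      qed
    qed
    \<comment> \<open>A fixed \<open>d\<close> eventually enters the regime. The constant
      \<open>1 / (2 * d ^ d)\<close> combines \<open>n choose d \<ge> (n / d) ^ d\<close> with the
      factor 1/2 from \<open>lower\<close>.\<close>
    have "\<forall>\<^sub>F n in at_top. real d \<le> real n powr (1 / 3)" by real_asymp
    then have "\<forall>\<^sub>F n in at_top. 1 / (2 * real d ^ d) * norm (real n ^ d) \<le> norm (?Q n d)"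
      using eventually_ge_at_top[of N] eventually_ge_at_top[of d]
    proof eventually_elim
      case (elim n)
      have "real n ^ d / real d ^ d \<le> real (n choose d)"
        using binomial_ge_n_over_k_pow_k[OF elim(3), where 'a = real] by (simp add: power_divide)
      also have "\<dots> \<le> real (num_monomials n d)"
        unfolding num_monomials_def of_nat_le_iff by (rule member_le_sum) simp_all
      also have "\<dots> / 2 \<le> ?Q n d" using lower[OF elim(2) d elim(1)] .
      finally show ?case by simp
    qed
    then show "(\<lambda>n. ?Q n d) \<in> \<Omega>(\<lambda>n. real n ^ d)"
      by (rule landau_omega.bigI[rotated]) (use d in simp)
  qed
qed

end
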